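(* For every zonoid $A\subset\mathbb R^4$, $$\mathrm{vol}(A)\,\mathrm{vol}(P_{\{4\}}A)^{2}\ \le\ \mathrm{vol}(P_{\{1,4\}}A)\,\mathrm{vol}(P_{\{2,4\}}A)\,\mathrm{vol}(P_{\{3,4\}}A).$$
   Context: A zonotope is a Minkowski sum of finitely many line segments; a zonoid is a limit of zonotopes in the Hausdorff metric. For $I\subseteq\{1,\dots,n\}$, $P_I$ is the orthogonal projection of $\mathbb R^n$ onto the coordinate subspace spanned by the standard basis vectors $e_i$, $i\in I$, and $\mathrm{vol}(P_IA)$ is the $|I|$-dimensional volume of $P_IA$ in that subspace. *)

theory Defs
  imports "HOL-Analysis.Analysis"
begin

definition zonotope :: "'a::euclidean_space set \<Rightarrow> bool" where
  "zonotope Z \<longleftrightarrow>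
     (\<exists>(m::nat) (a::nat \<Rightarrow> 'a) (b::nat \<Rightarrow> 'a). Z = (\<Sum>i<m. closed_segment (a i) (b i)))"

(* The suprema are genuine (bounded, over nonempty sets) only for nonempty bounded S and T. *)
definition hausdorff_dist :: "'a::metric_space set \<Rightarrow> 'a set \<Rightarrow> real" where
  "hausdorff_dist S T = max (SUP x\<in>S. infdist x T) (SUP y\<in>T. infdist y S)"

(* Limits are taken in the space of nonempty compact sets, on which the Hausdorff
   distance is a metric. *)
definition zonoid :: "'a::euclidean_space set \<Rightarrow> bool" where
  "zonoid A \<longleftrightarrow> compact A \<and> A \<noteq> {} \<and>
     (\<exists>Z :: nat \<Rightarrow> 'a set. (\<forall>k. zonotope (Z k)) \<and> (\<lambda>k. hausdorff_dist (Z k) A) \<longlonglongrightarrow> 0)"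

definition coord_proj :: "'n set \<Rightarrow> real ^ 'n \<Rightarrow> real ^ 'n::finite" where
  "coord_proj I x = (\<chi> i. if i \<in> I then x $ i else 0)"

(* The |I|-dimensional volume of a subset S of the coordinate subspace spanned by the
   axis i 1 with i in I: this subspace is identified isometrically with R^I by forgetting
   the vanishing coordinates, and R^I carries the product of one-dimensional Lebesgue
   measures. Only meaningful when S lies in that subspace. *)
definition coord_vol :: "'n set \<Rightarrow> (real ^ 'n::finite) set \<Rightarrow> real" where
  "coord_vol I S = measure (\<Pi>\<^sub>M i\<in>I. (lborel :: real measure)) ((\<lambda>x. \<lambda>i\<in>I. x $ i) ` S)"

(* Coordinates of R^4 are indexed by the numeral type 4, whose elements are 1, 2, 3 and
   4 = 0; they are pairwise distinct: *)
lemma UNIV_index_4: "(UNIV :: 4 set) = {1, 2, 3, 4}" "card {1, 2, 3, 4 :: 4} = 4"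
proof -
  show U: "(UNIV :: 4 set) = {1, 2, 3, 4}" by (rule UNIV_4)
  show "card {1, 2, 3, 4 :: 4} = 4" unfolding U[symmetric] by simp
qed

end

theory Submission
  imports Defs
begin

text \<open>For a zonotope that is a sum of segments \<open>[0, v\<^sub>i]\<close>, the volumes in question are sums of
  absolute values of minors: convexity makes the volume of \<open>\<Sum> s\<^sub>i [0, v\<^sub>i]\<close> affine in every
  \<open>s\<^sub>i\<close>, and it is homogeneous of degree \<open>n\<close>, so it is the sum of the volumes of the
  parallelepipeds spanned by \<open>n\<close> of the \<open>v\<^sub>i\<close>. Normalise the last coordinates \<open>t\<^sub>i\<close> to be
  positive and write \<open>v\<^sub>i = t\<^sub>i (x\<^sub>i, y\<^sub>i, z\<^sub>i, 1)\<close>. As a function of \<open>x\<close> the left-hand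
  side is sublinear and vanishes on constants, whereas \<open>\<Sum> t\<^sub>i t\<^sub>j \<bar>x\<^sub>i - x\<^sub>j\<bar>\<close> is additive over the
  layers of \<open>x\<close>; so \<open>x\<close>, and likewise \<open>y\<close> and \<open>z\<close>, may be taken to be indicator functions.
  Then the points are vertices of a cube and the claim is a polynomial inequality in the
  eight masses there. A zonoid is approximated from outside by zonotopes, so that only the upper
  semicontinuity of Lebesgue measure on compact sets is needed for the limit.\<close>

section \<open>Points at the vertices of a cube\<close>

text \<open>Minors of a family of vectors: each coordinate is a function on the index set, and the
  trailing arguments pick the vectors. The larger minors come from these by Laplace expansion, so
  that all identities between them are polynomial and fall to \<open>algebra\<close>.\<close>

definition det2 :: "('i \<Rightarrow> real) \<Rightarrow> ('i \<Rightarrow> real) \<Rightarrow> 'i \<Rightarrow> 'i \<Rightarrow> real" where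
  "det2 x y i j = x i * y j - x j * y i"

definition det3 :: "('i \<Rightarrow> real) \<Rightarrow> ('i \<Rightarrow> real) \<Rightarrow> ('i \<Rightarrow> real) \<Rightarrow> 'i \<Rightarrow> 'i \<Rightarrow> 'i \<Rightarrow> real" where
  "det3 x y z i j k = x i * det2 y z j k - x j * det2 y z i k + x k * det2 y z i j"

definition det4 :: "('i \<Rightarrow> real) \<Rightarrow> ('i \<Rightarrow> real) \<Rightarrow> ('i \<Rightarrow> real) \<Rightarrow> ('i \<Rightarrow> real) \<Rightarrow>
    'i \<Rightarrow> 'i \<Rightarrow> 'i \<Rightarrow> 'i \<Rightarrow> real" where
  "det4 x y z t i j k l = x i * det3 y z t j k l - x j * det3 y z t i k l
     + x k * det3 y z t i j l - x l * det3 y z t i j k"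

lemmas det4_expand = det4_def det3_def det2_def

text \<open>Up to sign, six times the volume of the tetrahedron with the four given vertices. The
  coordinates are separate real arguments so that a sum over one vertex can be taken while the
  others stay fixed.\<close>

definition tet :: "real \<Rightarrow> real \<Rightarrow> real \<Rightarrow> real \<Rightarrow> real \<Rightarrow> real \<Rightarrow> real \<Rightarrow> real \<Rightarrow> real \<Rightarrow> real \<Rightarrow> real \<Rightarrow> real \<Rightarrow> real"
  where "tet x1 y1 z1 x2 y2 z2 x3 y3 z3 x4 y4 z4 =
    (x2 - x1) * ((y3 - y1) * (z4 - z1) - (y4 - y1) * (z3 - z1))
  - (x3 - x1) * ((y2 - y1) * (z4 - z1) - (y4 - y1) * (z2 - z1))
  + (x4 - x1) * ((y2 - y1) * (z3 - z1) - (y3 - y1) * (z2 - z1))"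

lemma det4_one: "\<bar>det4 x y z (\<lambda>_. 1) i j k l\<bar>
   = \<bar>tet (x i) (y i) (z i) (x j) (y j) (z j) (x k) (y k) (z k) (x l) (y l) (z l)\<bar>"
  unfolding abs_eq_iff tet_def det4_expand by algebra

text \<open>Twice the area of a plane triangle. It appears when a tetrahedron has a face in one
  layer and its apex in the other, at height 1 above it.\<close>

definition tri :: "real \<Rightarrow> real \<Rightarrow> real \<Rightarrow> real \<Rightarrow> real \<Rightarrow> real \<Rightarrow> real" where
  "tri x1 y1 x2 y2 x3 y3 = \<bar>(x2 - x1) * (y3 - y1) - (x3 - x1) * (y2 - y1)\<bar>"

text \<open>The cross product of the two plane vectors \<open>p1 - p2\<close> and
  \<open>p3 - p4\<close>. It appears when two opposite edges of a tetrahedron lie in different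
  layers.\<close>

definition crs :: "real \<Rightarrow> real \<Rightarrow> real \<Rightarrow> real \<Rightarrow> real \<Rightarrow> real \<Rightarrow> real \<Rightarrow> real \<Rightarrow> real" where
  "crs x1 y1 x2 y2 x3 y3 x4 y4 = \<bar>(x1 - x2) * (y3 - y4) - (x3 - x4) * (y1 - y2)\<bar>"

text \<open>A tetrahedron with vertices in the planes \<open>z = 0\<close> and \<open>z = 1\<close>, according to which vertices are on top.\<close>

lemma abs_tet_layers:
  "\<bar>tet x1 y1 z x2 y2 z x3 y3 z x4 y4 z\<bar> = 0"
  "\<bar>tet x1 y1 1 x2 y2 0 x3 y3 0 x4 y4 0\<bar> = tri x2 y2 x3 y3 x4 y4"
  "\<bar>tet x1 y1 0 x2 y2 1 x3 y3 0 x4 y4 0\<bar> = tri x1 y1 x3 y3 x4 y4"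
  "\<bar>tet x1 y1 0 x2 y2 0 x3 y3 1 x4 y4 0\<bar> = tri x1 y1 x2 y2 x4 y4"
  "\<bar>tet x1 y1 0 x2 y2 0 x3 y3 0 x4 y4 1\<bar> = tri x1 y1 x2 y2 x3 y3"
  "\<bar>tet x1 y1 0 x2 y2 1 x3 y3 1 x4 y4 1\<bar> = tri x2 y2 x3 y3 x4 y4"
  "\<bar>tet x1 y1 1 x2 y2 0 x3 y3 1 x4 y4 1\<bar> = tri x1 y1 x3 y3 x4 y4"
  "\<bar>tet x1 y1 1 x2 y2 1 x3 y3 0 x4 y4 1\<bar> = tri x1 y1 x2 y2 x4 y4"
  "\<bar>tet x1 y1 1 x2 y2 1 x3 y3 1 x4 y4 0\<bar> = tri x1 y1 x2 y2 x3 y3"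
  "\<bar>tet x1 y1 1 x2 y2 1 x3 y3 0 x4 y4 0\<bar> = crs x1 y1 x2 y2 x3 y3 x4 y4"
  "\<bar>tet x1 y1 1 x2 y2 0 x3 y3 1 x4 y4 0\<bar> = crs x1 y1 x3 y3 x2 y2 x4 y4"
  "\<bar>tet x1 y1 1 x2 y2 0 x3 y3 0 x4 y4 1\<bar> = crs x1 y1 x4 y4 x2 y2 x3 y3"
  "\<bar>tet x1 y1 0 x2 y2 1 x3 y3 1 x4 y4 0\<bar> = crs x2 y2 x3 y3 x1 y1 x4 y4"
  "\<bar>tet x1 y1 0 x2 y2 1 x3 y3 0 x4 y4 1\<bar> = crs x2 y2 x4 y4 x1 y1 x3 y3"
  "\<bar>tet x1 y1 0 x2 y2 0 x3 y3 1 x4 y4 1\<bar> = crs x3 y3 x4 y4 x1 y1 x2 y2"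
  unfolding abs_eq_iff tet_def tri_def crs_def abs_0_eq
  by (simp, algebra+)

text \<open>The integral of \<open>f\<close> against the measure on \<open>{0,1}\<^sup>2\<close> with masses \<open>a, b, c, d\<close> at
  \<open>(0,0), (0,1), (1,0), (1,1)\<close>.\<close>

definition E4 :: "real \<Rightarrow> real \<Rightarrow> real \<Rightarrow> real \<Rightarrow> (real \<Rightarrow> real \<Rightarrow> real) \<Rightarrow> real" where
  "E4 a b c d f = a * f 0 0 + b * f 0 1 + c * f 1 0 + d * f 1 1"

lemma E4_const: "E4 a b c d (\<lambda>x y. u) = (a + b + c + d) * u"
  by (simp add: E4_def algebra_simps)

lemma E4_add: "E4 a b c d (\<lambda>x y. f x y + g x y) = E4 a b c d f + E4 a b c d g"
  by (simp add: E4_def algebra_simps)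

lemma E4_cmult: "E4 a b c d (\<lambda>x y. u * f x y) = u * E4 a b c d f"
  by (simp add: E4_def algebra_simps)

lemma E4_swap: "E4 a b c d (\<lambda>x y. E4 a' b' c' d' (\<lambda>x' y'. f x y x' y'))
   = E4 a' b' c' d' (\<lambda>x' y'. E4 a b c d (\<lambda>x y. f x y x' y'))"
  by (simp add: E4_def algebra_simps)

text \<open>Three distinct corners of the unit square span a triangle with \<open>tri\<close> equal
  to 1, and repeated corners give 0. Each of the four triangles is met in 6 orders.\<close>

lemma E4_tri:
  "E4 a b c d (\<lambda>x1 y1. E4 a b c d (\<lambda>x2 y2. E4 a b c d (\<lambda>x3 y3. tri x1 y1 x2 y2 x3 y3)))
   = 6 * (a*b*c + a*b*d + a*c*d + b*c*d)"
  unfolding E4_def tri_def by simp algebra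

text \<open>Two distinct corners of the square differ by a horizontal, a vertical or one of two
  diagonal vectors. The four products of masses collect the pairs of each direction, and the factor
  2 counts their orders.\<close>

lemma E4_crs_inner:
  "E4 a b c d (\<lambda>x1 y1. E4 a b c d (\<lambda>x2 y2. crs x1 y1 x2 y2 x3 y3 x4 y4))
   = 2 * ((a*c+b*d) * \<bar>y3-y4\<bar> + (a*b+c*d) * \<bar>x3-x4\<bar> + a*d*\<bar>(y3-y4)-(x3-x4)\<bar> + b*c*\<bar>(y3-y4)+(x3-x4)\<bar>)"
proof -
  have "E4 a b c d (\<lambda>x1 y1. E4 a b c d (\<lambda>x2 y2. \<bar>(x1 - x2) * r - s * (y1 - y2)\<bar>))
    = 2 * ((a*c+b*d) * \<bar>r\<bar> + (a*b+c*d) * \<bar>s\<bar> + a*d*\<bar>r-s\<bar> + b*c*\<bar>r+s\<bar>)" for r s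
  proof -
    have e: "\<bar>s - r\<bar> = \<bar>r - s\<bar>" "\<bar>- s - r\<bar> = \<bar>r + s\<bar>" "\<bar>- r - s\<bar> = \<bar>r + s\<bar>" "\<bar>s + r\<bar> = \<bar>r + s\<bar>" 
       "\<bar>- r + s\<bar> = \<bar>r - s\<bar>" "\<bar>- s + r\<bar> = \<bar>r - s\<bar>" by auto
    show ?thesis
      unfolding E4_def by (simp add: e) algebra
  qed
  then show ?thesis unfolding crs_def .
qed

lemma E4_crs:
  "E4 a' b' c' d' (\<lambda>x3 y3. E4 a' b' c' d' (\<lambda>x4 y4. E4 a b c d (\<lambda>x1 y1. E4 a b c d (\<lambda>x2 y2. crs x1 y1 x2 y2 x3 y3 x4 y4))))
   = 4 * ((a*c+b*d + a*d+b*c) * (a'*b'+c'*d' + a'*d'+b'*c') + (a*b+c*d+a*d+b*c) * (a'*c'+b'*d' + a'*d'+b'*c')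
        - (a*d+b*c)*(a'*d'+b'*c') - (a*d-b*c)*(a'*d'-b'*c'))"
  unfolding E4_crs_inner unfolding E4_def by simp algebra


text \<open>The masses of the vertices of the unit cube are \<open>a, b, c, d\<close> in the layer \<open>z = 1\<close> and
  \<open>a', b', c', d'\<close> in the layer \<open>z = 0\<close>. After multiplication by \<open>Q * R\<close> both sides factor, up to
  squares and nonnegative terms, through \<open>R * A + Q * A'\<close> and \<open>R * B + Q * B'\<close>.\<close>

lemma cell_inequality:
  fixes a b c d :: real
  assumes nn: "a \<ge> 0" "b \<ge> 0" "c \<ge> 0" "d \<ge> 0" "a' \<ge> 0" "b' \<ge> 0" "c' \<ge> 0" "d' \<ge> 0"
  defines "Q \<equiv> a + b + c + d" and "R \<equiv> a' + b' + c' + d'"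
  shows "(Q + R)\<^sup>2 * (Q * (a'*b'*c' + a'*b'*d' + a'*c'*d' + b'*c'*d') + R * (a*b*c + a*b*d + a*c*d + b*c*d)
     + ((a*c+b*d + a*d+b*c) * (a'*b'+c'*d' + a'*d'+b'*c') + (a*b+c*d+a*d+b*c) * (a'*c'+b'*d' + a'*d'+b'*c')
        - (a*d+b*c)*(a'*d'+b'*c') - (a*d-b*c)*(a'*d'-b'*c')))
    \<le> (a + b + a' + b') * (c + d + c' + d') * ((a + c + a' + c') * (b + d + b' + d')) * (Q * R)"
    (is "_ * ?L \<le> ?X * ?Y * _")
proof (cases "Q = 0 \<or> R = 0")
  \<comment> \<open>With an empty layer both sides vanish. The other case ends by cancelling the
    factor \<open>Q * R\<close>.\<close>
  case True
  then have "a = 0 \<and> b = 0 \<and> c = 0 \<and> d = 0 \<or> a' = 0 \<and> b' = 0 \<and> c' = 0 \<and> d' = 0"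
    using nn unfolding Q_def R_def by linarith
  then show ?thesis unfolding Q_def R_def by auto
next
  case False
  then have QR: "Q > 0" "R > 0" using nn by (auto simp: Q_def R_def)
  define A B A' B' where "A = (a+b)*(c+d)" and "B = (a+c)*(b+d)" and "A' = (a'+b')*(c'+d')" and "B' = (a'+c')*(b'+d')"
  define r r' where "r = a*d - b*c" and "r' = a'*d' - b'*c'"
  have e: "Q * (a*b*c + a*b*d + a*c*d + b*c*d) = A * B - r\<^sup>2"
    "R * (a'*b'*c' + a'*b'*d' + a'*c'*d' + b'*c'*d') = A' * B' - r'\<^sup>2"
    unfolding Q_def R_def A_def B_def r_def A'_def B'_def r'_def by algebra+
  have mid: "(a*c+b*d + a*d+b*c) * (a'*b'+c'*d' + a'*d'+b'*c') + (a*b+c*d+a*d+b*c) * (a'*c'+b'*d' + a'*d'+b'*c')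
    = A * B' + B * A'" unfolding A_def B_def A'_def B'_def by algebra
  have "Q * R * ?L = Q\<^sup>2 * (R * (a'*b'*c' + a'*b'*d' + a'*c'*d' + b'*c'*d')) + R\<^sup>2 * (Q * (a*b*c + a*b*d + a*c*d + b*c*d))
     + Q * R * (A * B' + B * A' - (a*d+b*c)*(a'*d'+b'*c') - r * r')"
    unfolding mid r_def[symmetric] r'_def[symmetric] by algebra
  also have "\<dots> = (R * A + Q * A') * (R * B + Q * B') - Q * R * ((a*d+b*c)*(a'*d'+b'*c'))
      - ((Q * r')\<^sup>2 + (R * r)\<^sup>2 + (Q * r') * (R * r))"
    unfolding e by algebra
  also have "\<dots> \<le> (R * A + Q * A') * (R * B + Q * B')"
  proof -
    have "0 \<le> u\<^sup>2 + v\<^sup>2 + u * v" for u v :: real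
    proof -
      have "u\<^sup>2 + v\<^sup>2 + u * v = (u + v / 2)\<^sup>2 + 3 * (v / 2)\<^sup>2" by (simp add: power2_eq_square field_simps)
      then show ?thesis by simp
    qed
    moreover have "0 \<le> Q * R * ((a*d+b*c)*(a'*d'+b'*c'))" using nn QR by simp
    ultimately show ?thesis by (smt (verit))
  qed
  finally have 1: "Q * R * ?L \<le> (R * A + Q * A') * (R * B + Q * B')" .
  \<comment> \<open>This is the law of total variance for the first coordinate, cleared of
    denominators: \<open>A\<close> and \<open>A'\<close> are the parts within the layers and the
    square is the part between them.\<close>
  have "Q * R * ?X = (Q + R) * (R * A + Q * A') + ((a + b) * (c' + d') - (a' + b') * (c + d))\<^sup>2"
    unfolding Q_def R_def A_def A'_def by algebra
  then have 2: "(Q + R) * (R * A + Q * A') \<le> Q * R * ?X" by simp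
  have "Q * R * ?Y = (Q + R) * (R * B + Q * B') + ((a + c) * (b' + d') - (a' + c') * (b + d))\<^sup>2"
    unfolding Q_def R_def B_def B'_def by algebra
  then have 3: "(Q + R) * (R * B + Q * B') \<le> Q * R * ?Y" by simp
  have "0 \<le> A" "0 \<le> B" "0 \<le> A'" "0 \<le> B'" using nn unfolding A_def B_def A'_def B'_def by simp_all
  then have nnp: "0 \<le> (Q + R) * (R * A + Q * A')" "0 \<le> (Q + R) * (R * B + Q * B')" using QR by simp_all
  have "(Q * R) * ((Q + R)\<^sup>2 * ?L) = (Q + R)\<^sup>2 * (Q * R * ?L)" by simp
  also have "\<dots> \<le> (Q + R)\<^sup>2 * ((R * A + Q * A') * (R * B + Q * B'))"
    using 1 by (intro mult_left_mono) auto
  also have "\<dots> = ((Q + R) * (R * A + Q * A')) * ((Q + R) * (R * B + Q * B'))"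
    by (simp add: power2_eq_square)
  also have "\<dots> \<le> (Q * R * ?X) * (Q * R * ?Y)"
    by (rule mult_mono[OF 2 3]) (use nnp 2 in linarith)+
  also have "\<dots> = (Q * R) * (?X * ?Y * (Q * R))" by simp
  finally show ?thesis using QR by (subst (asm) mult_le_cancel_left_pos) auto
qed

text \<open>A weighted sum over points with coordinates in {0,1} sees only the total mass at each
  vertex of the cube. The masses are chosen before \<open>f\<close>, so the same eight numbers serve
  for every level of a nested sum.\<close>

lemma sum_cells:
  fixes t x y z :: "'i \<Rightarrow> real"
  assumes "\<And>i. i \<in> I \<Longrightarrow> x i \<in> {0,1}" "\<And>i. i \<in> I \<Longrightarrow> y i \<in> {0,1}" "\<And>i. i \<in> I \<Longrightarrow> z i \<in> {0,1}"
    and t: "\<And>i. i \<in> I \<Longrightarrow> t i \<ge> 0"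
  obtains a b c d a' b' c' d' where
    "a \<ge> 0" "b \<ge> 0" "c \<ge> 0" "d \<ge> 0" "a' \<ge> 0" "b' \<ge> 0" "c' \<ge> 0" "d' \<ge> (0::real)"
    "\<And>f. (\<Sum>i\<in>I. t i * f (x i) (y i) (z i))
       = E4 a b c d (\<lambda>u v. f u v 1) + E4 a' b' c' d' (\<lambda>u v. f u v 0)"
proof -
  \<comment> \<open>On {0,1} the factor \<open>u * x i + (1-u) * (1 - x i)\<close> is 1 if
    \<open>x i = u\<close> and 0 otherwise, so \<open>w u v s i\<close> is \<open>t i\<close> if
    point \<open>i\<close> sits at the vertex \<open>(u, v, s)\<close> and 0 otherwise.\<close>
  define w where "w u v s i = t i * (u * x i + (1-u) * (1 - x i)) * (v * y i + (1-v) * (1 - y i)) * (s * z i + (1-s)*(1-z i))" for u v s i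
  have "(\<Sum>i\<in>I. t i * f (x i) (y i) (z i)) = (\<Sum>i\<in>I. E4 (w 0 0 1 i) (w 0 1 1 i) (w 1 0 1 i) (w 1 1 1 i) (\<lambda>u v. f u v 1)
    + E4 (w 0 0 0 i) (w 0 1 0 i) (w 1 0 0 i) (w 1 1 0 i) (\<lambda>u v. f u v 0))" for f
  proof (rule sum.cong[OF refl])
    fix i assume "i \<in> I"
    then have "x i \<in> {0,1}" "y i \<in> {0,1}" "z i \<in> {0,1}" using assms by auto
    then show "t i * f (x i) (y i) (z i) = E4 (w 0 0 1 i) (w 0 1 1 i) (w 1 0 1 i) (w 1 1 1 i) (\<lambda>u v. f u v 1)
    + E4 (w 0 0 0 i) (w 0 1 0 i) (w 1 0 0 i) (w 1 1 0 i) (\<lambda>u v. f u v 0)"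
      unfolding w_def E4_def by auto
  qed
  then have eq: "(\<Sum>i\<in>I. t i * f (x i) (y i) (z i)) =
    E4 (sum (w 0 0 1) I) (sum (w 0 1 1) I) (sum (w 1 0 1) I) (sum (w 1 1 1) I) (\<lambda>u v. f u v 1)
    + E4 (sum (w 0 0 0) I) (sum (w 0 1 0) I) (sum (w 1 0 0) I) (sum (w 1 1 0) I) (\<lambda>u v. f u v 0)" for f
    by (simp add: E4_def sum.distrib sum_distrib_right)
  have nn: "0 \<le> sum (w u v s) I" if "u \<in> {0,1}" "v \<in> {0,1}" "s \<in> {0,1}" for u v s
  proof (rule sum_nonneg)
    fix i assume "i \<in> I"
    then have "x i \<in> {0,1}" "y i \<in> {0,1}" "z i \<in> {0,1}" "t i \<ge> 0" using assms t by auto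
    then show "0 \<le> w u v s i" using that unfolding w_def by auto
  qed
  show ?thesis by (rule that[OF _ _ _ _ _ _ _ _ eq]) (use nn in auto)
qed

text \<open>Split the quadruple sum by the layers of the four points. A lone point in one layer has
  4 positions and leaves a sum of triangles with factor 6; two points in each layer have 6
  arrangements and leave a sum with factor 4. Both give 24 times a term of
  \<open>cell_inequality\<close>.\<close>

lemma indicator_inequality:
  fixes t x y z :: "'i \<Rightarrow> real"
  assumes xyz: "\<And>i. i \<in> I \<Longrightarrow> x i \<in> {0,1}" "\<And>i. i \<in> I \<Longrightarrow> y i \<in> {0,1}" "\<And>i. i \<in> I \<Longrightarrow> z i \<in> {0,1}"
    and t: "\<And>i. i \<in> I \<Longrightarrow> t i \<ge> 0"
  shows "(\<Sum>i\<in>I. t i)\<^sup>2 * (\<Sum>i\<in>I. t i * (\<Sum>j\<in>I. t j * (\<Sum>k\<in>I. t k * (\<Sum>l\<in>I. t l * \<bar>det4 x y z (\<lambda>_. 1) i j k l\<bar>))))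
    \<le> 3 * (\<Sum>i\<in>I. t i * (\<Sum>j\<in>I. t j * \<bar>x i - x j\<bar>)) * (\<Sum>i\<in>I. t i * (\<Sum>j\<in>I. t j * \<bar>y i - y j\<bar>))
        * (\<Sum>i\<in>I. t i * (\<Sum>j\<in>I. t j * \<bar>z i - z j\<bar>))"
proof -
  obtain a b c d a' b' c' d' where nn:
    "a \<ge> 0" "b \<ge> 0" "c \<ge> 0" "d \<ge> 0" "a' \<ge> 0" "b' \<ge> 0" "c' \<ge> 0" "d' \<ge> (0::real)"
    and S: "\<And>f. (\<Sum>i\<in>I. t i * f (x i) (y i) (z i))
       = E4 a b c d (\<lambda>u v. f u v 1) + E4 a' b' c' d' (\<lambda>u v. f u v 0)"
    proof (rule sum_cells[where x=x and y=y and z=z and t=t and I=I, OF xyz t], goal_cases)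
    case (5 a b c d a' b' c' d')
    then show ?case by (intro that[of a b c d a' b' c' d'])
  qed
  have T: "(\<Sum>i\<in>I. t i) = (a + b + c + d) + (a' + b' + c' + d')"
    using S[of "\<lambda>_ _ _. 1"] by (simp add: E4_const)
  have X: "(\<Sum>i\<in>I. t i * (\<Sum>j\<in>I. t j * \<bar>x i - x j\<bar>)) = 2 * ((a + b + a' + b') * (c + d + c' + d'))"
  proof -
    have 1: "(\<Sum>j\<in>I. t j * \<bar>p - x j\<bar>) = E4 a b c d (\<lambda>u v. \<bar>p - u\<bar>) + E4 a' b' c' d' (\<lambda>u v. \<bar>p - u\<bar>)" for p
      by (rule S[where f = "\<lambda>u v w. \<bar>p - u\<bar>"])
    show ?thesis unfolding 1
      unfolding S[where f = "\<lambda>u v w. E4 a b c d (\<lambda>u' v'. \<bar>u - u'\<bar>) + E4 a' b' c' d' (\<lambda>u' v'. \<bar>u - u'\<bar>)"]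
      by (simp add: E4_def algebra_simps)
  qed
  have Y: "(\<Sum>i\<in>I. t i * (\<Sum>j\<in>I. t j * \<bar>y i - y j\<bar>)) = 2 * ((a + c + a' + c') * (b + d + b' + d'))"
  proof -
    have 1: "(\<Sum>j\<in>I. t j * \<bar>p - y j\<bar>) = E4 a b c d (\<lambda>u v. \<bar>p - v\<bar>) + E4 a' b' c' d' (\<lambda>u v. \<bar>p - v\<bar>)" for p
      by (rule S[where f = "\<lambda>u v w. \<bar>p - v\<bar>"])
    show ?thesis unfolding 1
      unfolding S[where f = "\<lambda>u v w. E4 a b c d (\<lambda>u' v'. \<bar>v - v'\<bar>) + E4 a' b' c' d' (\<lambda>u' v'. \<bar>v - v'\<bar>)"]
      by (simp add: E4_def algebra_simps)
  qed
  have Z: "(\<Sum>i\<in>I. t i * (\<Sum>j\<in>I. t j * \<bar>z i - z j\<bar>)) = 2 * ((a + b + c + d) * (a' + b' + c' + d'))"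
  proof -
    have 1: "(\<Sum>j\<in>I. t j * \<bar>p - z j\<bar>) = E4 a b c d (\<lambda>u v. \<bar>p - 1\<bar>) + E4 a' b' c' d' (\<lambda>u v. \<bar>p - 0\<bar>)" for p
      by (rule S[where f = "\<lambda>u v w. \<bar>p - w\<bar>"])
    show ?thesis unfolding 1
      unfolding S[where f = "\<lambda>u v w. E4 a b c d (\<lambda>u' v'. \<bar>w - 1\<bar>) + E4 a' b' c' d' (\<lambda>u' v'. \<bar>w - 0\<bar>)"]
      by (simp add: E4_def algebra_simps)
  qed
  let ?q = "E4 a b c d" and ?r = "E4 a' b' c' d'"
  let ?t = "\<lambda>x1 y1 z1 x2 y2 z2 x3 y3 z3 x4 y4 z4. \<bar>tet x1 y1 z1 x2 y2 z2 x3 y3 z3 x4 y4 z4\<bar>"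
  \<comment> \<open>\<open>?f3\<close>, \<open>?f2\<close> and \<open>?f1\<close> are the sums over
    the last one, two and three vertices, with the remaining vertices as parameters. The nested sum
    is evaluated from the inside out through them.\<close>
  let ?f3 = "\<lambda>x1 y1 z1 x2 y2 z2 x3 y3 z3. ?q (\<lambda>x4 y4. ?t x1 y1 z1 x2 y2 z2 x3 y3 z3 x4 y4 1) + ?r (\<lambda>x4 y4. ?t x1 y1 z1 x2 y2 z2 x3 y3 z3 x4 y4 0)"
  let ?f2 = "\<lambda>x1 y1 z1 x2 y2 z2. ?q (\<lambda>x3 y3. ?f3 x1 y1 z1 x2 y2 z2 x3 y3 1) + ?r (\<lambda>x3 y3. ?f3 x1 y1 z1 x2 y2 z2 x3 y3 0)"
  let ?f1 = "\<lambda>x1 y1 z1. ?q (\<lambda>x2 y2. ?f2 x1 y1 z1 x2 y2 1) + ?r (\<lambda>x2 y2. ?f2 x1 y1 z1 x2 y2 0)"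
  have V: "(\<Sum>i\<in>I. t i * (\<Sum>j\<in>I. t j * (\<Sum>k\<in>I. t k * (\<Sum>l\<in>I. t l * \<bar>det4 x y z (\<lambda>_. 1) i j k l\<bar>))))
     = ?q (\<lambda>x1 y1. ?f1 x1 y1 1) + ?r (\<lambda>x1 y1. ?f1 x1 y1 0)"
  proof -
    have 3: "(\<Sum>l\<in>I. t l * \<bar>det4 x y z (\<lambda>_. 1) i j k l\<bar>) = ?f3 (x i) (y i) (z i) (x j) (y j) (z j) (x k) (y k) (z k)" for i j k
      unfolding det4_one by (rule S[where f = "\<lambda>u v w. ?t (x i) (y i) (z i) (x j) (y j) (z j) (x k) (y k) (z k) u v w"])
    have 2: "(\<Sum>k\<in>I. t k * (\<Sum>l\<in>I. t l * \<bar>det4 x y z (\<lambda>_. 1) i j k l\<bar>)) = ?f2 (x i) (y i) (z i) (x j) (y j) (z j)" for i j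
      unfolding 3 by (rule S[where f = "\<lambda>u v w. ?f3 (x i) (y i) (z i) (x j) (y j) (z j) u v w"])
    have 1: "(\<Sum>j\<in>I. t j * (\<Sum>k\<in>I. t k * (\<Sum>l\<in>I. t l * \<bar>det4 x y z (\<lambda>_. 1) i j k l\<bar>))) = ?f1 (x i) (y i) (z i)" for i
      unfolding 2 by (rule S[where f = "\<lambda>u v w. ?f2 (x i) (y i) (z i) u v w"])
    show ?thesis unfolding 1 by (rule S[where f = "\<lambda>u v w. ?f1 u v w"])
  qed
  \<comment> \<open>Rewriting with this moves every sum over the lower layer outside the sums over
    the upper one, which is the order of summation in \<open>E4_crs\<close>.\<close>
  have qr: "?q (\<lambda>u v. ?r (\<lambda>u' v'. g u v u' v')) = ?r (\<lambda>u' v'. ?q (\<lambda>u v. g u v u' v'))" for g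
    by (rule E4_swap)
  have V': "(\<Sum>i\<in>I. t i * (\<Sum>j\<in>I. t j * (\<Sum>k\<in>I. t k * (\<Sum>l\<in>I. t l * \<bar>det4 x y z (\<lambda>_. 1) i j k l\<bar>))))
    = 24 * ((a + b + c + d) * (a'*b'*c' + a'*b'*d' + a'*c'*d' + b'*c'*d') + (a' + b' + c' + d') * (a*b*c + a*b*d + a*c*d + b*c*d)
     + ((a*c+b*d + a*d+b*c) * (a'*b'+c'*d' + a'*d'+b'*c') + (a*b+c*d+a*d+b*c) * (a'*c'+b'*d' + a'*d'+b'*c')
        - (a*d+b*c)*(a'*d'+b'*c') - (a*d-b*c)*(a'*d'-b'*c')))"
    unfolding V E4_add abs_tet_layers
    unfolding qr E4_const E4_cmult E4_tri E4_crs by algebra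
  \<comment> \<open>Each of the three double sums carries a factor 2 for the order of its pair, and
    \<open>3 * 2^3\<close> matches the 24 of the quadruple sum.\<close>
  have assoc: "3 * (2 * u) * (2 * v) * (2 * w) = 24 * (u * v * w)" for u v w :: real by simp
  show ?thesis
    unfolding T X Y Z V' mult.left_commute[of _ "24 :: real"] assoc
    by (rule mult_left_mono[OF cell_inequality[OF nn]]) simp
qed

section \<open>Reduction to indicator functions\<close>

text \<open>On \<open>I\<close>, \<open>X\<close> is a constant plus a nonnegative combination of
  indicators of nested superlevel sets. Along this decomposition \<open>f\<close> is subadditive,
  while the right-hand side is additive because the layers all order \<open>i\<close> and
  \<open>j\<close> the same way. The induction is on the number of values of
  \<open>X\<close>.\<close>

lemma layer_cake:
  fixes f :: "('i \<Rightarrow> real) \<Rightarrow> real" and t :: "'i \<Rightarrow> real"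
  assumes I: "finite I"
    and sub: "\<And>X Y. f (\<lambda>i. X i + Y i) \<le> f X + f Y"
    and hom: "\<And>c X. 0 \<le> c \<Longrightarrow> f (\<lambda>i. c * X i) = c * f X"
    and const: "\<And>c. f (\<lambda>_. c) \<le> 0"
    and cong: "\<And>X Y. (\<And>i. i \<in> I \<Longrightarrow> X i = Y i) \<Longrightarrow> f X = f Y"
    and ind: "\<And>S. f (indicator S) \<le> C * (\<Sum>i\<in>I. t i * (\<Sum>j\<in>I. t j * \<bar>indicator S i - indicator S j\<bar>))"
  shows "f X \<le> C * (\<Sum>i\<in>I. t i * (\<Sum>j\<in>I. t j * \<bar>X i - X j\<bar>))"
proof (induction "card (X ` I)" arbitrary: X rule: less_induct)
  case less
  define g where "g X = (\<Sum>i\<in>I. t i * (\<Sum>j\<in>I. t j * \<bar>X i - X j\<bar>))" for X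
  show ?case
  proof (cases "card (X ` I) \<le> 1")
    case True
    then obtain c where c: "\<And>i. i \<in> I \<Longrightarrow> X i = c"
      using I by (metis card_le_Suc0_iff_eq finite_imageI imageI One_nat_def)
    then have "g X = 0" unfolding g_def by simp
    moreover have "f X \<le> 0" using cong[of X "\<lambda>_. c"] const[of c] c by simp
    ultimately show ?thesis by (simp add: g_def)
  next
    case False
    \<comment> \<open>Peel off the top layer of \<open>X\<close>: lower its maximum \<open>M\<close> to the second largest value \<open>N\<close>.\<close>
    define M where "M = Max (X ` I)"
    define N where "N = Max (X ` I - {M})"
    have ne: "X ` I \<noteq> {}" using False by force
    then have M: "M \<in> X ` I" "\<And>i. i \<in> I \<Longrightarrow> X i \<le> M"
      unfolding M_def using I by auto
    have ne': "X ` I - {M} \<noteq> {}"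
    proof
      assume "X ` I - {M} = {}"
      then have "X ` I \<subseteq> {M}" by blast
      then have "card (X ` I) \<le> card {M}" by (intro card_mono) auto
      then show False using False by simp
    qed
    then have "N \<in> X ` I - {M}"
      unfolding N_def using I by (intro Max_in) auto
    moreover have "X i \<le> N" if "i \<in> I" "X i \<noteq> M" for i
      unfolding N_def using I that by (intro Max_ge) auto
    ultimately have N: "N \<in> X ` I - {M}" "\<And>i. i \<in> I \<Longrightarrow> X i \<noteq> M \<Longrightarrow> X i \<le> N" by blast+
    then have NM: "N < M" using M by fastforce
    define S where "S = {i. X i = M}"
    define X' where "X' i = (if X i = M then N else X i)" for i
    have "X' ` I \<subseteq> X ` I - {M}" using N NM unfolding X'_def by auto
    then have "card (X' ` I) < card (X ` I)" using M I
      by (metis card_Diff1_less card_mono finite_Diff finite_imageI le_less_trans)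
    then have 1: "f X' \<le> C * g X'" using less unfolding g_def by blast
    have "f X = f (\<lambda>i. X' i + (M - N) * indicator S i)"
      by (rule cong) (auto simp: X'_def S_def)
    also have "\<dots> \<le> f X' + f (\<lambda>i. (M - N) * indicator S i)" by (rule sub)
    also have "\<dots> = f X' + (M - N) * f (indicator S)" using hom[of "M - N"] NM by simp
    also have "\<dots> \<le> C * g X' + (M - N) * (C * g (indicator S))"
      using 1 ind[of S] NM unfolding g_def by (intro add_mono mult_left_mono) auto
    also have "\<dots> = C * (g X' + (M - N) * g (indicator S))" by (simp add: algebra_simps)
    also have "g X' + (M - N) * g (indicator S) = (\<Sum>i\<in>I. t i * (\<Sum>j\<in>I. t j * (\<bar>X' i - X' j\<bar> + (M - N) * \<bar>indicator S i - indicator S j\<bar>)))"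
      unfolding g_def by (simp add: sum.distrib sum_subtractf sum_distrib_left algebra_simps)
    also have "\<dots> = g X" unfolding g_def
    proof (intro sum.cong refl arg_cong2[where f = "(*)"])
      fix i j assume "i \<in> I" "j \<in> I"
      then show "\<bar>X' i - X' j\<bar> + (M - N) * \<bar>indicator S i - indicator S j\<bar> = \<bar>X i - X j\<bar>"
        using N(2)[of i] N(2)[of j] NM unfolding X'_def S_def by (auto simp: indicator_def)
    qed
    finally show ?thesis unfolding g_def .
  qed
qed

definition wsum :: "'i set \<Rightarrow> ('i \<Rightarrow> real) \<Rightarrow> ('i \<Rightarrow> real) \<Rightarrow> ('i \<Rightarrow> real) \<Rightarrow> ('i \<Rightarrow> real) \<Rightarrow> real" where
  "wsum I t x y z = (\<Sum>i\<in>I. t i * (\<Sum>j\<in>I. t j * (\<Sum>k\<in>I. t k * (\<Sum>l\<in>I. t l * \<bar>det4 x y z (\<lambda>_. 1) i j k l\<bar>))))"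

text \<open>Exchanging coordinates only changes the sign of the determinant. So it suffices to study
  \<open>wsum\<close> as a function of its first coordinate.\<close>

lemma wsum_swap: "wsum I t x y z = wsum I t y x z" "wsum I t x y z = wsum I t z y x"
proof -
  have "\<bar>det4 x y z (\<lambda>_. 1) i j k l\<bar> = \<bar>det4 y x z (\<lambda>_. 1) i j k l\<bar>"
    "\<bar>det4 x y z (\<lambda>_. 1) i j k l\<bar> = \<bar>det4 z y x (\<lambda>_. 1) i j k l\<bar>" for i j k l
    unfolding abs_eq_iff det4_expand by algebra+
  then show "wsum I t x y z = wsum I t y x z" "wsum I t x y z = wsum I t z y x"
    unfolding wsum_def by simp_all
qed

lemma wsum_cong:
  assumes "\<And>i. i \<in> I \<Longrightarrow> x i = x' i"
  shows "wsum I t x y z = wsum I t x' y z"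
  unfolding wsum_def det4_expand using assms by (simp cong: sum.cong)

lemma wsum_cmult:
  assumes "0 \<le> c"
  shows "wsum I t (\<lambda>i. c * x i) y z = c * wsum I t x y z"
proof -
  have "\<bar>det4 (\<lambda>i. c * x i) y z (\<lambda>_. 1) i j k l\<bar> = c * \<bar>det4 x y z (\<lambda>_. 1) i j k l\<bar>" for i j k l
  proof -
    have "det4 (\<lambda>i. c * x i) y z (\<lambda>_. 1) i j k l = c * det4 x y z (\<lambda>_. 1) i j k l"
      unfolding det4_expand by algebra
    then show ?thesis using assms by (simp add: abs_mult)
  qed
  then show ?thesis unfolding wsum_def by (simp add: sum_distrib_left mult.left_commute)
qed

lemma wsum_const: "wsum I t (\<lambda>_. c) y z = 0"
proof -
  have "det4 (\<lambda>_. c) y z (\<lambda>_. 1) i j k l = 0" for i j k l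
    unfolding det4_expand by algebra
  then show ?thesis unfolding wsum_def by simp
qed

lemma wsum_add:
  assumes "\<And>i. i \<in> I \<Longrightarrow> 0 \<le> t i"
  shows "wsum I t (\<lambda>i. x i + x' i) y z \<le> wsum I t x y z + wsum I t x' y z"
proof -
  have "det4 (\<lambda>i. x i + x' i) y z (\<lambda>_. 1) i j k l = det4 x y z (\<lambda>_. 1) i j k l + det4 x' y z (\<lambda>_. 1) i j k l" for i j k l
    unfolding det4_expand by algebra
  then show ?thesis unfolding wsum_def sum.distrib[symmetric] distrib_left[symmetric]
    using assms by (intro sum_mono mult_left_mono) auto
qed

lemma wsum_inequality:
  fixes t x y z :: "'i \<Rightarrow> real"
  assumes I: "finite I" and t: "\<And>i. i \<in> I \<Longrightarrow> 0 \<le> t i"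
  shows "(\<Sum>i\<in>I. t i)\<^sup>2 * wsum I t x y z
    \<le> 3 * (\<Sum>i\<in>I. t i * (\<Sum>j\<in>I. t j * \<bar>x i - x j\<bar>)) * (\<Sum>i\<in>I. t i * (\<Sum>j\<in>I. t j * \<bar>y i - y j\<bar>))
        * (\<Sum>i\<in>I. t i * (\<Sum>j\<in>I. t j * \<bar>z i - z j\<bar>))"
proof -
  define T where "T = (\<Sum>i\<in>I. t i)\<^sup>2"
  define g where "g X = (\<Sum>i\<in>I. t i * (\<Sum>j\<in>I. t j * \<bar>X i - X j\<bar>))" for X
  have T: "T \<ge> 0" unfolding T_def by simp
  have layer: "T * wsum I t X y z \<le> C * g X"
    if "\<And>S. T * wsum I t (indicator S) y z \<le> C * g (indicator S)" for X y z C
    unfolding g_def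
  proof (rule layer_cake[OF I])
    show "T * wsum I t (\<lambda>i. X i + Y i) y z \<le> T * wsum I t X y z + T * wsum I t Y y z" for X Y
      using mult_left_mono[OF wsum_add[OF t] T] by (simp add: distrib_left)
    show "T * wsum I t (\<lambda>i. c * X i) y z = c * (T * wsum I t X y z)" if "0 \<le> c" for c X
      using that by (simp add: wsum_cmult)
    show "T * wsum I t (\<lambda>_. c) y z \<le> 0" for c by (simp add: wsum_const)
    show "T * wsum I t X y z = T * wsum I t Y y z" if "\<And>i. i \<in> I \<Longrightarrow> X i = Y i" for X Y
      using wsum_cong[of I X Y, OF that] by simp
  qed (use that in \<open>simp add: g_def\<close>)
  \<comment> \<open>From here the coordinates are released from being indicators one at a time. Each
    pass treats the first argument of \<open>wsum\<close>, the factors \<open>g\<close> of the other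
    two being absorbed into the constant \<open>C\<close>; symmetry then brings the next coordinate
    to the front.\<close>
  have 0: "T * wsum I t (indicator A) (indicator B) (indicator D) \<le> 3 * g (indicator B) * g (indicator D) * g (indicator A)" for A B D
  proof -
    have "indicator S i \<in> {0, 1::real}" for S and i :: 'i by (auto simp: indicator_def)
    then show ?thesis
      using indicator_inequality[of I "indicator A" "indicator B" "indicator D" t] t
      unfolding T_def g_def wsum_def by (simp add: mult_ac)
  qed
  have 1: "T * wsum I t x (indicator B) (indicator D) \<le> 3 * g (indicator B) * g (indicator D) * g x" for B D x
    by (rule layer) (rule 0)
  have 2: "T * wsum I t y x (indicator D) \<le> 3 * g x * g (indicator D) * g y" for x D y
    by (rule layer) (use 1[of x _ D] in \<open>simp add: wsum_swap(1)[of _ _ _ x] mult_ac\<close>)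
  have "T * wsum I t z y x \<le> 3 * g x * g y * g z"
    by (rule layer) (use 2[of y x _] in \<open>simp add: wsum_swap(2)[of _ _ _ y x] wsum_swap(1)[of _ _ x y] mult_ac\<close>)
  then show ?thesis unfolding T_def g_def using wsum_swap(2)[of I t x y z] by simp
qed

text \<open>Dividing vector \<open>i\<close> by \<open>t i\<close> makes its last coordinate 1. By
  linearity of determinants in each vector, the removed factors reappear as the weights in
  \<open>wsum\<close>.\<close>

lemma det_sum_inequality_pos:
  fixes t x y z :: "'i \<Rightarrow> real"
  assumes I: "finite I" and t: "\<And>i. i \<in> I \<Longrightarrow> 0 < t i"
  shows "(\<Sum>i\<in>I. t i)\<^sup>2 * (\<Sum>i\<in>I. \<Sum>j\<in>I. \<Sum>k\<in>I. \<Sum>l\<in>I. \<bar>det4 x y z t i j k l\<bar>)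
    \<le> 3 * (\<Sum>i\<in>I. \<Sum>j\<in>I. \<bar>det2 x t i j\<bar>) * (\<Sum>i\<in>I. \<Sum>j\<in>I. \<bar>det2 y t i j\<bar>) * (\<Sum>i\<in>I. \<Sum>j\<in>I. \<bar>det2 z t i j\<bar>)"
proof -
  have 2: "(\<Sum>i\<in>I. t i * (\<Sum>j\<in>I. t j * \<bar>x i / t i - x j / t j\<bar>)) = (\<Sum>i\<in>I. \<Sum>j\<in>I. \<bar>det2 x t i j\<bar>)" for x
    unfolding sum_distrib_left
  proof (intro sum.cong refl)
    fix i j assume "i \<in> I" "j \<in> I"
    then have p: "t i > 0" "t j > 0" using t by auto
    then have "det2 x t i j = t i * (t j * (x i / t i - x j / t j))"
      by (simp add: det2_def field_simps)
    then show "t i * (t j * \<bar>x i / t i - x j / t j\<bar>) = \<bar>det2 x t i j\<bar>" using p by (simp add: abs_mult)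
  qed
  have "wsum I t (\<lambda>i. x i / t i) (\<lambda>i. y i / t i) (\<lambda>i. z i / t i) = (\<Sum>i\<in>I. \<Sum>j\<in>I. \<Sum>k\<in>I. \<Sum>l\<in>I. \<bar>det4 x y z t i j k l\<bar>)"
    unfolding wsum_def sum_distrib_left
  proof (intro sum.cong refl)
    fix i j k l assume "i \<in> I" "j \<in> I" "k \<in> I" "l \<in> I"
    then have p: "t i > 0" "t j > 0" "t k > 0" "t l > 0" using t by auto
    define X Y Z where "X i = x i / t i" and "Y i = y i / t i" and "Z i = z i / t i" for i
    have e: "x u = t u * X u" "y u = t u * Y u" "z u = t u * Z u" if "t u > 0" for u
      using that unfolding X_def Y_def Z_def by auto
    have "det4 x y z t i j k l = t i * (t j * (t k * (t l * det4 X Y Z (\<lambda>_. 1) i j k l)))"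
      unfolding det4_expand e[OF p(1)] e[OF p(2)] e[OF p(3)] e[OF p(4)] by algebra
    then show "t i * (t j * (t k * (t l * \<bar>det4 (\<lambda>i. x i / t i) (\<lambda>i. y i / t i) (\<lambda>i. z i / t i) (\<lambda>_. 1) i j k l\<bar>))) = \<bar>det4 x y z t i j k l\<bar>"
      using p unfolding X_def[abs_def] Y_def[abs_def] Z_def[abs_def] by (simp add: abs_mult)
  qed
  then show ?thesis
    using wsum_inequality[OF I, of t "\<lambda>i. x i / t i" "\<lambda>i. y i / t i" "\<lambda>i. z i / t i"] t
    unfolding 2 by (simp add: less_imp_le)
qed

text \<open>Both sides are continuous in \<open>t\<close>, so the positive case is applied to
  \<open>t i + 1 / (n + 1)\<close> and \<open>n\<close> tends to infinity.\<close>

lemma det_sum_inequality_nonneg: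
  fixes t x y z :: "'i \<Rightarrow> real"
  assumes I: "finite I" and t: "\<And>i. i \<in> I \<Longrightarrow> 0 \<le> t i"
  shows "(\<Sum>i\<in>I. t i)\<^sup>2 * (\<Sum>i\<in>I. \<Sum>j\<in>I. \<Sum>k\<in>I. \<Sum>l\<in>I. \<bar>det4 x y z t i j k l\<bar>)
    \<le> 3 * (\<Sum>i\<in>I. \<Sum>j\<in>I. \<bar>det2 x t i j\<bar>) * (\<Sum>i\<in>I. \<Sum>j\<in>I. \<bar>det2 y t i j\<bar>) * (\<Sum>i\<in>I. \<Sum>j\<in>I. \<bar>det2 z t i j\<bar>)"
    (is "?L t \<le> ?R t")
proof -
  define e where "e n = 1 / real (Suc n)" for n
  have e: "e \<longlonglongrightarrow> 0" unfolding e_def by (rule LIMSEQ_Suc) (rule lim_1_over_n)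
  let ?t = "\<lambda>n i. t i + e n"
  have t': "(\<lambda>n. ?t n i) \<longlonglongrightarrow> t i" for i
    using tendsto_add[OF tendsto_const e] by simp
  have L: "(\<lambda>n. ?L (?t n)) \<longlonglongrightarrow> ?L t"
    unfolding det4_expand by (intro tendsto_intros t')
  have R: "(\<lambda>n. ?R (?t n)) \<longlonglongrightarrow> ?R t"
    unfolding det4_expand by (intro tendsto_intros t')
  have "?L (?t n) \<le> ?R (?t n)" for n
    by (rule det_sum_inequality_pos[OF I]) (use t in \<open>simp add: e_def add_nonneg_pos\<close>)
  then show ?thesis using LIMSEQ_le[OF L R] by blast
qed

text \<open>Replacing a vector by its negative changes no absolute value of a minor, so every last
  coordinate may be made nonnegative.\<close>

lemma det_sum_inequality:
  fixes t x y z :: "'i \<Rightarrow> real"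
  assumes I: "finite I"
  shows "(\<Sum>i\<in>I. \<bar>t i\<bar>)\<^sup>2 * (\<Sum>i\<in>I. \<Sum>j\<in>I. \<Sum>k\<in>I. \<Sum>l\<in>I. \<bar>det4 x y z t i j k l\<bar>)
    \<le> 3 * (\<Sum>i\<in>I. \<Sum>j\<in>I. \<bar>det2 x t i j\<bar>) * (\<Sum>i\<in>I. \<Sum>j\<in>I. \<bar>det2 y t i j\<bar>) * (\<Sum>i\<in>I. \<Sum>j\<in>I. \<bar>det2 z t i j\<bar>)"
proof -
  define s :: "'i \<Rightarrow> real" where "s i = (if t i < 0 then - 1 else 1)" for i
  have s: "\<bar>s i\<bar> = 1" for i unfolding s_def by simp
  have 2: "\<bar>det2 (\<lambda>i. s i * x i) (\<lambda>i. s i * t i) i j\<bar> = \<bar>det2 x t i j\<bar>" for x i j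
  proof -
    have "det2 (\<lambda>i. s i * x i) (\<lambda>i. s i * t i) i j = s i * s j * det2 x t i j"
      unfolding det2_def by algebra
    then show ?thesis by (simp add: abs_mult s)
  qed
  have 4: "\<bar>det4 (\<lambda>i. s i * x i) (\<lambda>i. s i * y i) (\<lambda>i. s i * z i) (\<lambda>i. s i * t i) i j k l\<bar> = \<bar>det4 x y z t i j k l\<bar>" for i j k l
  proof -
    have "det4 (\<lambda>i. s i * x i) (\<lambda>i. s i * y i) (\<lambda>i. s i * z i) (\<lambda>i. s i * t i) i j k l = s i * s j * s k * s l * det4 x y z t i j k l"
      unfolding det4_expand by algebra
    then show ?thesis by (simp add: abs_mult s)
  qed
  have "(\<lambda>i. \<bar>t i\<bar>) = (\<lambda>i. s i * t i)" by (auto simp: s_def)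
  then show ?thesis
    using det_sum_inequality_nonneg[OF I, of "\<lambda>i. s i * t i" "\<lambda>i. s i * x i" "\<lambda>i. s i * y i" "\<lambda>i. s i * z i"]
    unfolding 2 4 by (simp add: fun_eq_iff) (metis abs_ge_zero)
qed

section \<open>Volumes of zonotopes\<close>

lemma compact_set_plus:
  fixes S T :: "'a::real_normed_vector set"
  assumes "compact S" "compact T"
  shows "compact (S + T)"
proof -
  have "S + T = {x + y | x y. x \<in> S \<and> y \<in> T}" unfolding set_plus_def by blast
  then show ?thesis using compact_sums[OF assms] by simp
qed

lemma compact_set_sum:
  fixes S :: "'i \<Rightarrow> 'a::real_normed_vector set"
  assumes "\<And>i. i \<in> I \<Longrightarrow> compact (S i)"
  shows "compact (\<Sum>i\<in>I. S i)"
  using assms by (induction I rule: infinite_finite_induct) (auto simp: compact_set_plus set_zero)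

lemma image_set_plus:
  assumes "linear f"
  shows "f ` (S + T) = f ` S + f ` T"
  unfolding set_plus_image using assms by (force simp: linear_add image_iff)

lemma image_set_sum:
  assumes "linear f"
  shows "f ` (\<Sum>i\<in>I. S i) = (\<Sum>i\<in>I. f ` S i)"
  by (induction I rule: infinite_finite_induct) (auto simp: image_set_plus[OF assms] linear_0[OF assms] set_zero)

lemma mem_plus_segment:
  fixes v :: "'a::real_vector"
  assumes "0 \<le> c"
  shows "x \<in> S + closed_segment 0 (c *\<^sub>R v) \<longleftrightarrow> (\<exists>p\<in>S. \<exists>r. 0 \<le> r \<and> r \<le> c \<and> x = p + r *\<^sub>R v)"
proof
  assume "x \<in> S + closed_segment 0 (c *\<^sub>R v)"
  then obtain p u where "p \<in> S" "0 \<le> u" "u \<le> 1" "x = p + (u * c) *\<^sub>R v"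
    by (auto simp: set_plus_def closed_segment_def)
  then show "\<exists>p\<in>S. \<exists>r. 0 \<le> r \<and> r \<le> c \<and> x = p + r *\<^sub>R v"
    using assms by (auto intro!: bexI[of _ p] exI[of _ "u * c"] simp: mult_left_le_one_le)
next
  assume "\<exists>p\<in>S. \<exists>r. 0 \<le> r \<and> r \<le> c \<and> x = p + r *\<^sub>R v"
  then obtain p r where pr: "p \<in> S" "0 \<le> r" "r \<le> c" "x = p + r *\<^sub>R v" by blast
  have "r *\<^sub>R v \<in> closed_segment 0 (c *\<^sub>R v)"
  proof (cases "c = 0")
    case False
    then show ?thesis using pr assms
      by (auto simp: closed_segment_def intro!: exI[of _ "r / c"])
  qed (use pr in auto)
  then show "x \<in> S + closed_segment 0 (c *\<^sub>R v)" using pr by (auto simp: set_plus_def)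
qed

text \<open>By convexity, lines in direction \<open>v\<close> meet \<open>S\<close> in intervals, so what is added at the far end
  of \<open>S\<close> does not depend on how far it has already been extended.\<close>

lemma plus_segment_diff:
  fixes v :: "'a::real_vector"
  assumes "convex S" "0 \<le> c" "0 \<le> d"
  shows "(S + closed_segment 0 ((c + d) *\<^sub>R v)) - (S + closed_segment 0 (c *\<^sub>R v))
    = (+) (c *\<^sub>R v) ` ((S + closed_segment 0 (d *\<^sub>R v)) - S)" (is "?L = ?R")
proof (intro equalityI subsetI)
  fix x assume "x \<in> ?L"
  then obtain p r where p: "p \<in> S" "0 \<le> r" "r \<le> c + d" "x = p + r *\<^sub>R v" and nx: "x \<notin> S + closed_segment 0 (c *\<^sub>R v)"
    using mem_plus_segment[of "c + d" x S v] assms by auto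
  then have r: "r > c" using mem_plus_segment[OF assms(2)] by (meson not_le)
  have "x - c *\<^sub>R v = p + (r - c) *\<^sub>R v" using p by (simp add: algebra_simps)
  then have "x - c *\<^sub>R v \<in> S + closed_segment 0 (d *\<^sub>R v)"
    using p r mem_plus_segment[OF assms(3)] by (metis add_le_cancel_left diff_add_cancel diff_ge_0_iff_ge add.commute less_imp_le)
  moreover have "x - c *\<^sub>R v \<notin> S"
  proof
    assume "x - c *\<^sub>R v \<in> S"
    then have "x \<in> S + closed_segment 0 (c *\<^sub>R v)"
      unfolding mem_plus_segment[OF assms(2)] using assms by (intro bexI[of _ "x - c *\<^sub>R v"] exI[of _ c]) auto
    then show False using nx by simp
  qed
  ultimately show "x \<in> ?R" by (intro image_eqI[of _ _ "x - c *\<^sub>R v"]) auto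
next
  fix x assume "x \<in> ?R"
  then obtain y where "x = c *\<^sub>R v + y" "y \<in> S + closed_segment 0 (d *\<^sub>R v)" "y \<notin> S" by auto
  then obtain p r where p: "p \<in> S" "0 \<le> r" "r \<le> d" "x = c *\<^sub>R v + (p + r *\<^sub>R v)" and nS: "p + r *\<^sub>R v \<notin> S"
    using mem_plus_segment[OF assms(3), of y S v] by auto
  have "x \<in> S + closed_segment 0 ((c + d) *\<^sub>R v)"
    unfolding mem_plus_segment[OF add_nonneg_nonneg[OF assms(2,3)]] using p assms
    by (intro bexI[of _ p] exI[of _ "c + r"]) (auto simp: algebra_simps)
  moreover have "x \<notin> S + closed_segment 0 (c *\<^sub>R v)"
  proof
    assume "x \<in> S + closed_segment 0 (c *\<^sub>R v)"
    then obtain q r' where q: "q \<in> S" "0 \<le> r'" "r' \<le> c" "x = q + r' *\<^sub>R v"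
      using mem_plus_segment[OF assms(2), of x S v] by auto
    \<comment> \<open>Here \<open>q\<close> lies on the line through \<open>p\<close> in direction
      \<open>v\<close>, at parameter \<open>m\<close> with \<open>0 < r\<close> and
      \<open>r \<le> m\<close>. So the point at parameter \<open>r\<close> lies between
      \<open>p\<close> and \<open>q\<close>, and convexity puts it into \<open>S\<close>, against
      \<open>nS\<close>.\<close>
    define m where "m = c + r - r'"
    have qm: "q = p + m *\<^sub>R v" using p q unfolding m_def by (simp add: algebra_simps)
    have rm: "r \<le> m" using q unfolding m_def by simp
    have "r \<noteq> 0" using nS p by auto
    then have m: "m > 0" using rm p by simp
    have "p + r *\<^sub>R v = (1 - r / m) *\<^sub>R p + (r / m) *\<^sub>R q"
      unfolding qm using m by (simp add: algebra_simps)
    moreover have "(1 - r / m) *\<^sub>R p + (r / m) *\<^sub>R q \<in> S"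
      using assms(1) p q rm m by (intro convexD) auto
    ultimately show False using nS by simp
  qed
  ultimately show "x \<in> ?L" by simp
qed

text \<open>By \<open>plus_segment_diff\<close>, every further copy of \<open>v\<close> adds a
  translate of the same set, hence the same volume. Integer lengths are enough for the polynomial
  argument that follows.\<close>

lemma measure_plus_segment:
  fixes v :: "'a::euclidean_space"
  assumes S: "convex S" "compact S"
  shows "measure lebesgue (S + closed_segment 0 (real k *\<^sub>R v))
    = measure lebesgue S + real k * (measure lebesgue (S + closed_segment 0 v) - measure lebesgue S)"
proof (induction k)
  case 0
  then show ?case by (simp flip: set_zero)
next
  case (Suc k)
  let ?S = "\<lambda>c. S + closed_segment 0 (c *\<^sub>R v)"
  have lm: "?S c \<in> lmeasurable" for c
    by (intro lmeasurable_compact compact_set_plus S compact_segment)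
  have sub: "?S c \<subseteq> ?S d" if "0 \<le> c" "c \<le> d" for c d
    using that by (auto simp: mem_plus_segment) (metis order_trans)
  have S0: "?S 0 = S" by (simp flip: set_zero)
  have "measure lebesgue (?S (real k + 1)) - measure lebesgue (?S (real k)) = measure lebesgue (?S (real k + 1) - ?S (real k))"
    by (rule measurable_measure_Diff[symmetric]) (use lm sub in auto)
  also have "\<dots> = measure lebesgue (?S 1 - S)"
    using plus_segment_diff[OF S(1), of "real k" 1 v] by (simp add: measure_translation)
  also have "\<dots> = measure lebesgue (?S 1) - measure lebesgue (?S 0)"
    using sub[of 0 1] lm[of 0] lm[of 1] unfolding S0 by (intro measurable_measure_Diff) auto
  finally show ?case using Suc S0 by (simp add: algebra_simps)
qed

text \<open>A function that is affine in each variable separately is a polynomial with one monomial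
  for each set of variables. The induction splits off variable \<open>i\<close>: \<open>G0\<close>
  is the value at 0 and \<open>G1\<close> the slope, and both are affine in each remaining
  variable.\<close>

lemma multiaffine_expansion:
  fixes F :: "('i \<Rightarrow> nat) \<Rightarrow> real"
  assumes "finite I"
    and "\<And>i s k. i \<in> I \<Longrightarrow> F (s(i := k)) = F (s(i := 0)) + real k * (F (s(i := 1)) - F (s(i := 0)))"
  shows "\<exists>c. \<forall>s. (\<forall>i. i \<notin> I \<longrightarrow> s i = 0) \<longrightarrow> F s = (\<Sum>B\<in>Pow I. c B * (\<Prod>i\<in>B. real (s i)))"
  using assms
proof (induction I arbitrary: F rule: finite_induct)
  case empty
  show ?case
  proof (intro exI[of _ "\<lambda>_. F (\<lambda>_. 0)"] allI impI)
    fix s :: "'i \<Rightarrow> nat" assume "\<forall>i. i \<notin> {} \<longrightarrow> s i = 0"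
    then have "s = (\<lambda>_. 0)" by auto
    then show "F s = (\<Sum>B\<in>Pow {}. F (\<lambda>_. 0) * (\<Prod>i\<in>B. real (s i)))" by simp
  qed
next
  case (insert i I)
  define G0 where "G0 s = F (s(i := 0))" for s
  define G1 where "G1 s = F (s(i := 1)) - F (s(i := 0))" for s
  have tw: "(s(j := k))(i := l) = (s(i := l))(j := k)" if "j \<in> I" for s :: "'i \<Rightarrow> nat" and j k l
    using that insert.hyps by (metis fun_upd_twist)
  have aff: "F (s(j := k)) = F (s(j := 0)) + real k * (F (s(j := 1)) - F (s(j := 0)))" if "j \<in> I" for j s k
    by (intro insert.prems insertI2 that)
  have "G0 (s(j := k)) = G0 (s(j := 0)) + real k * (G0 (s(j := 1)) - G0 (s(j := 0)))" if "j \<in> I" for j s k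
    unfolding G0_def tw[OF that] by (rule aff[OF that])
  then obtain c0 where c0: "\<And>s. (\<forall>j. j \<notin> I \<longrightarrow> s j = 0) \<Longrightarrow> G0 s = (\<Sum>B\<in>Pow I. c0 B * (\<Prod>j\<in>B. real (s j)))"
    using insert.IH[of G0] by blast
  have "G1 (s(j := k)) = G1 (s(j := 0)) + real k * (G1 (s(j := 1)) - G1 (s(j := 0)))" if "j \<in> I" for j s k
    unfolding G1_def tw[OF that] using aff[OF that, of "s(i:=0)" k] aff[OF that, of "s(i:=1)" k] by (simp add: algebra_simps)
  then obtain c1 where c1: "\<And>s. (\<forall>j. j \<notin> I \<longrightarrow> s j = 0) \<Longrightarrow> G1 s = (\<Sum>B\<in>Pow I. c1 B * (\<Prod>j\<in>B. real (s j)))"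
    using insert.IH[of G1] by blast
  \<comment> \<open>Monomials containing variable \<open>i\<close> come from the slope, the others
    from the value at 0.\<close>
  define c where "c B = (if i \<in> B then c1 (B - {i}) else c0 B)" for B
  show ?case
  proof (intro exI[of _ c] allI impI)
    fix s :: "'i \<Rightarrow> nat" assume s: "\<forall>j. j \<notin> insert i I \<longrightarrow> s j = 0"
    let ?s = "s(i := 0)"
    have s': "\<forall>j. j \<notin> I \<longrightarrow> ?s j = 0" using s by simp
    have pr: "(\<Prod>j\<in>B. real (?s j)) = (\<Prod>j\<in>B. real (s j))" if "B \<in> Pow I" for B
      using that insert.hyps by (intro prod.cong) auto
    have "F (s(i := s i)) = F (s(i := 0)) + real (s i) * (F (s(i := 1)) - F (s(i := 0)))"
      by (rule insert.prems) simp
    then have "F s = G0 ?s + real (s i) * G1 ?s"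
      unfolding G0_def G1_def by (simp only: fun_upd_triv fun_upd_upd)
    also have "\<dots> = (\<Sum>B\<in>Pow I. c B * (\<Prod>j\<in>B. real (s j))) + (\<Sum>B\<in>Pow I. c (insert i B) * (\<Prod>j\<in>insert i B. real (s j)))"
    proof -
      have "G0 ?s = (\<Sum>B\<in>Pow I. c B * (\<Prod>j\<in>B. real (s j)))"
        unfolding c0[OF s'] using insert.hyps pr by (intro sum.cong) (auto simp: c_def)
      moreover have "real (s i) * G1 ?s = (\<Sum>B\<in>Pow I. c (insert i B) * (\<Prod>j\<in>insert i B. real (s j)))"
        unfolding c1[OF s'] sum_distrib_left
      proof (rule sum.cong[OF refl])
        fix B assume B: "B \<in> Pow I"
        then have "i \<notin> B" "finite B" using insert.hyps finite_subset by auto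
        then show "real (s i) * (c1 B * (\<Prod>j\<in>B. real (?s j))) = c (insert i B) * (\<Prod>j\<in>insert i B. real (s j))"
          using pr[OF B] by (simp add: c_def)
      qed
      ultimately show ?thesis by simp
    qed
    also have "\<dots> = (\<Sum>B\<in>Pow (insert i I). c B * (\<Prod>j\<in>B. real (s j)))"
    proof -
      have "inj_on (insert i) (Pow I)" using insert.hyps by (auto simp: inj_on_def)
      then show ?thesis unfolding Pow_insert using insert.hyps
        by (subst sum.union_disjoint) (auto simp: sum.reindex)
    qed
    finally show "F s = (\<Sum>B\<in>Pow (insert i I). c B * (\<Prod>j\<in>B. real (s j)))" .
  qed
qed

text \<open>Doubling all variables multiplies the monomial of \<open>B\<close> by
  \<open>2 ^ card B\<close>, so homogeneity of degree \<open>n\<close> leaves only the monomials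
  with \<open>card B = n\<close>. The coefficient of such a \<open>B\<close> is read off at the
  indicator of \<open>B\<close>, where all its proper subsets contribute 0.\<close>

lemma multiaffine_homogeneous:
  fixes F :: "('i \<Rightarrow> nat) \<Rightarrow> real"
  assumes I: "finite I"
    and aff: "\<And>i s k. i \<in> I \<Longrightarrow> F (s(i := k)) = F (s(i := 0)) + real k * (F (s(i := 1)) - F (s(i := 0)))"
    and hom: "\<And>s. F (\<lambda>i. 2 * s i) = 2 ^ n * F s"
  shows "F (indicator I) = (\<Sum>B | B \<subseteq> I \<and> card B = n. F (indicator B))"
proof -
  obtain c where c: "\<And>s. (\<forall>i. i \<notin> I \<longrightarrow> s i = 0) \<Longrightarrow> F s = (\<Sum>B\<in>Pow I. c B * (\<Prod>i\<in>B. real (s i)))"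
    using multiaffine_expansion[OF I, of F] aff by blast
  have FS: "F (\<lambda>i. m * indicator S i) = (\<Sum>B\<in>Pow S. c B * real m ^ card B)" if S: "S \<subseteq> I" for S m
  proof -
    have "F (\<lambda>i. m * indicator S i) = (\<Sum>B\<in>Pow I. c B * (\<Prod>i\<in>B. real (m * indicator S i)))"
      by (rule c) (use S in \<open>auto simp: indicator_def\<close>)
    also have "\<dots> = (\<Sum>B\<in>Pow S. c B * (\<Prod>i\<in>B. real (m * indicator S i)))"
    proof (rule sum.mono_neutral_right)
      show "\<forall>B\<in>Pow I - Pow S. c B * (\<Prod>i\<in>B. real (m * indicator S i)) = 0"
      proof
        fix B assume "B \<in> Pow I - Pow S"
        then have "\<exists>i\<in>B. real (m * indicator S i) = 0" "finite B" using I finite_subset by (auto simp: indicator_def)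
        then show "c B * (\<Prod>i\<in>B. real (m * indicator S i)) = 0" using prod_zero by (metis mult_zero_right)
      qed
    qed (use I S in auto)
    also have "\<dots> = (\<Sum>B\<in>Pow S. c B * real m ^ card B)"
    proof (rule sum.cong[OF refl])
      fix B assume "B \<in> Pow S"
      then have "(\<Prod>i\<in>B. real (m * indicator S i)) = (\<Prod>i\<in>B. real m)"
        by (intro prod.cong) (auto simp: indicator_def)
      then show "c B * (\<Prod>i\<in>B. real (m * indicator S i)) = c B * real m ^ card B" by simp
    qed
    finally show ?thesis .
  qed
  have F1: "F (indicator S) = (\<Sum>B\<in>Pow S. c B)" if "S \<subseteq> I" for S
    using FS[OF that, of 1] by simp
  have c0: "c S = 0" if "S \<subseteq> I" "card S \<noteq> n" for S
    using that
  proof (induction "card S" arbitrary: S rule: less_induct)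
    case less
    have fS: "finite S" using less.prems I finite_subset by blast
    have split: "sum g (Pow S) = g S + sum g (Pow S - {S})" for g :: "'i set \<Rightarrow> real"
      using fS by (simp add: sum.remove)
    \<comment> \<open>By induction a proper subset of \<open>S\<close> either has coefficient 0 or
      has \<open>n\<close> elements, so its terms already scale by \<open>2 ^ n\<close>. Comparing
      the values at the indicator of \<open>S\<close> and at its double then leaves only the term of
      \<open>S\<close>.\<close>
    have "(\<Sum>B\<in>Pow S - {S}. c B * 2 ^ card B) = (\<Sum>B\<in>Pow S - {S}. 2 ^ n * c B)"
    proof (rule sum.cong[OF refl])
      fix B assume B: "B \<in> Pow S - {S}"
      then have "card B < card S" using fS by (auto intro: psubset_card_mono)
      then have "c B = 0 \<or> card B = n" using less.hyps[of B] B less.prems by auto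
      then show "c B * 2 ^ card B = 2 ^ n * c B" by auto
    qed
    moreover have "(\<Sum>B\<in>Pow S. c B * 2 ^ card B) = 2 ^ n * (\<Sum>B\<in>Pow S. c B)"
      using FS[OF less.prems(1), of 2] hom[of "indicator S"] F1[OF less.prems(1)] by simp
    ultimately have "c S * 2 ^ card S = 2 ^ n * c S"
      unfolding split by (simp add: distrib_left sum_distrib_left)
    then show ?case using less.prems(2) by auto
  qed
  have cn: "c S = F (indicator S)" if S: "S \<subseteq> I" "card S = n" for S
  proof -
    have fS: "finite S" using S I finite_subset by blast
    have "(\<Sum>B\<in>Pow S. c B) = c S + (\<Sum>B\<in>Pow S - {S}. c B)" using fS by (simp add: sum.remove)
    also have "(\<Sum>B\<in>Pow S - {S}. c B) = 0"
    proof (rule sum.neutral, rule ballI)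
      fix B assume B: "B \<in> Pow S - {S}"
      then have "card B < card S" using fS by (auto intro: psubset_card_mono)
      then show "c B = 0" using B S by (intro c0) auto
    qed
    finally show ?thesis using F1[OF S(1)] by simp
  qed
  have "F (indicator I) = (\<Sum>B\<in>Pow I. c B)" using F1 by simp
  also have "\<dots> = (\<Sum>B | B \<subseteq> I \<and> card B = n. c B)"
    by (rule sum.mono_neutral_right) (use I c0 in auto)
  also have "\<dots> = (\<Sum>B | B \<subseteq> I \<and> card B = n. F (indicator B))"
    using cn by (intro sum.cong) auto
  finally show ?thesis .
qed

text \<open>As a function of integer multiplicities of the \<open>v i\<close>, the volume is affine
  in each one by \<open>measure_plus_segment\<close> and homogeneous of degree
  \<open>DIM('a)\<close>. Setting multiplicities to 0 or 1 selects subfamilies.\<close>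

lemma measure_sum_segments:
  fixes v :: "'i \<Rightarrow> 'a::euclidean_space"
  assumes I: "finite I"
  shows "measure lebesgue (\<Sum>i\<in>I. closed_segment 0 (v i))
    = (\<Sum>B | B \<subseteq> I \<and> card B = DIM('a). measure lebesgue (\<Sum>i\<in>B. closed_segment 0 (v i)))"
proof -
  define Z where "Z s J = (\<Sum>i\<in>J. closed_segment 0 (real (s i) *\<^sub>R v i))" for s :: "'i \<Rightarrow> nat" and J
  define F where "F s = measure lebesgue (Z s I)" for s
  have aff: "F (s(i := k)) = F (s(i := 0)) + real k * (F (s(i := 1)) - F (s(i := 0)))" if "i \<in> I" for i s k
  proof -
    let ?S = "Z s (I - {i})"
    have "Z (s(i := m)) I = ?S + closed_segment 0 (real m *\<^sub>R v i)" for m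
      unfolding Z_def using I that
      by (subst sum.remove[OF I that]) (simp add: add.commute)
    moreover have "convex ?S" "compact ?S"
      unfolding Z_def by (auto intro!: convex_set_sum compact_set_sum)
    ultimately show ?thesis
      unfolding F_def by (simp add: measure_plus_segment flip: set_zero)
  qed
  have hom: "F (\<lambda>i. 2 * s i) = 2 ^ DIM('a) * F s" for s
  proof -
    have "linear (\<lambda>x::'a. 2 *\<^sub>R x)" by (rule linear_scaleR)
    then have "Z (\<lambda>i. 2 * s i) I = (\<lambda>x. 2 *\<^sub>R x) ` Z s I"
      unfolding Z_def by (simp add: image_set_sum closed_segment_linear_image[symmetric] mult_ac)
    then show ?thesis
      unfolding F_def using measure_lebesgue_affine[of 2 0 "Z s I"] by simp
  qed
  have ZB: "Z (indicator B) I = (\<Sum>i\<in>B. closed_segment 0 (v i))" if "B \<subseteq> I" for B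
  proof -
    have "Z (indicator B) I = (\<Sum>i\<in>I. if i \<in> B then closed_segment 0 (v i) else 0)"
      unfolding Z_def by (intro sum.cong) (auto simp: indicator_def set_zero)
    also have "\<dots> = (\<Sum>i\<in>B. closed_segment 0 (v i))"
      unfolding sum.inter_restrict[OF I, symmetric] using that by (simp add: Int_absorb1)
    finally show ?thesis .
  qed
  show ?thesis
    using multiaffine_homogeneous[OF I, of F, OF aff hom] ZB unfolding F_def by simp
qed

text \<open>The sum is the image of the unit cube under the linear map with columns
  \<open>w k\<close>; the matrix in the statement has the \<open>w k\<close> as rows, hence the
  transpose.\<close>

lemma measure_parallelepiped:
  fixes w :: "'n::{finite,wellorder} \<Rightarrow> real ^ 'n::_"
  shows "measure lebesgue (\<Sum>k\<in>UNIV. closed_segment 0 (w k)) = \<bar>det (\<chi> k. w k)\<bar>"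
proof -
  define f where "f x = (\<Sum>k\<in>UNIV. x $ k *\<^sub>R w k)" for x :: "real ^ 'n::_"
  have lin: "linear f" unfolding f_def
    by (rule linearI) (simp_all add: sum.distrib scaleR_add_left scaleR_sum_right)
  have "(\<Sum>k\<in>UNIV. closed_segment 0 (w k)) = f ` cbox 0 1"
  proof (intro equalityI subsetI)
    fix x assume "x \<in> (\<Sum>k\<in>UNIV. closed_segment 0 (w k))"
    then obtain s where x: "x = sum s UNIV" and s: "\<forall>k. s k \<in> closed_segment 0 (w k)"
      by (auto simp: set_sum_alt)
    then have "\<forall>k. \<exists>u. 0 \<le> u \<and> u \<le> 1 \<and> s k = u *\<^sub>R w k" by (auto simp: closed_segment_def)
    then obtain u where u: "\<And>k. 0 \<le> u k \<and> u k \<le> 1 \<and> s k = u k *\<^sub>R w k" by metis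
    have "x = f (\<chi> k. u k)" unfolding x f_def using u by simp
    then show "x \<in> f ` cbox 0 1" using u by (auto simp: mem_box_cart)
  next
    fix x assume "x \<in> f ` cbox 0 1"
    then obtain y where y: "x = f y" "\<forall>k. 0 \<le> y $ k \<and> y $ k \<le> 1" by (auto simp: mem_box_cart)
    then show "x \<in> (\<Sum>k\<in>UNIV. closed_segment 0 (w k))"
      unfolding f_def by (auto simp: set_sum_alt closed_segment_def intro!: exI[of _ "\<lambda>k. y $ k *\<^sub>R w k"])
  qed
  moreover have "measure lebesgue (cbox 0 (1 :: real ^ 'n::_)) = 1"
    by (subst measure_completion) (simp_all add: content_cbox_cart interval_ne_empty_cart)
  moreover have "matrix f = transpose (\<chi> k. w k)"
    by (simp add: matrix_def transpose_def vec_eq_iff f_def axis_def if_distrib[of "\<lambda>a. a * _"] cong: if_cong)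
  ultimately show ?thesis
    using measure_linear_image[OF lin, of "cbox 0 1"] by (simp add: det_transpose)
qed

text \<open>Double counting of pairs of a set \<open>B\<close> and an element \<open>i\<close> of
  it, with \<open>C = B - {i}\<close>. Writing 0 for \<open>i \<in> C\<close> keeps the range of
  \<open>C\<close> independent of \<open>i\<close>, so that the rule can be iterated.\<close>

lemma sum_subsets_Suc:
  fixes g :: "'i set \<Rightarrow> real"
  assumes I: "finite I"
  shows "real (Suc n) * (\<Sum>B | B \<subseteq> I \<and> card B = Suc n. g B)
    = (\<Sum>i\<in>I. \<Sum>C | C \<subseteq> I \<and> card C = n. if i \<in> C then 0 else g (insert i C))"
proof -
  have fin: "finite {C. C \<subseteq> I \<and> card C = m}" for m using I by simp
  have "(\<Sum>i\<in>I. \<Sum>C | C \<subseteq> I \<and> card C = n. if i \<in> C then 0 else g (insert i C))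
    = (\<Sum>i\<in>I. \<Sum>C | C \<subseteq> I \<and> card C = n \<and> i \<notin> C. g (insert i C))"
    using fin by (intro sum.cong refl sum.mono_neutral_cong_right) (auto intro: finite_subset[OF _ fin])
  also have "\<dots> = (\<Sum>(i, C)\<in>Sigma I (\<lambda>i. {C. C \<subseteq> I \<and> card C = n \<and> i \<notin> C}). g (insert i C))"
    using I by (intro sum.Sigma) auto
  also have "\<dots> = (\<Sum>(B, i)\<in>Sigma {B. B \<subseteq> I \<and> card B = Suc n} (\<lambda>B. B). g B)"
    by (rule sum.reindex_bij_witness[where j = "\<lambda>(i, C). (insert i C, i)" and i = "\<lambda>(B, i). (i, B - {i})"])
      (use I in \<open>auto simp: insert_absorb card_insert_if dest: finite_subset\<close>)
  also have "\<dots> = (\<Sum>B | B \<subseteq> I \<and> card B = Suc n. \<Sum>i\<in>B. g B)"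
    using I by (intro sum.Sigma[symmetric]) (auto dest: finite_subset)
  also have "\<dots> = real (Suc n) * (\<Sum>B | B \<subseteq> I \<and> card B = Suc n. g B)"
    by (simp add: sum_distrib_left)
  finally show ?thesis by simp
qed

lemma sum_subsets_0: "finite I \<Longrightarrow> (\<Sum>B | B \<subseteq> I \<and> card B = 0. g B) = g {}"
proof -
  assume "finite I"
  then have "{B. B \<subseteq> I \<and> card B = 0} = {{}}" by (auto dest: finite_subset)
  then show ?thesis by simp
qed

lemma sum_subsets_2:
  fixes g :: "'i set \<Rightarrow> real"
  assumes I: "finite I"
  shows "2 * (\<Sum>B | B \<subseteq> I \<and> card B = 2. g B) = (\<Sum>i\<in>I. \<Sum>j\<in>I. if i = j then 0 else g {i, j})"
proof -
  let ?S = "\<lambda>n g. \<Sum>B | B \<subseteq> I \<and> card B = n. g B :: real"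
  have S: "?S (Suc n) g = (\<Sum>i\<in>I. ?S n (\<lambda>C. if i \<in> C then 0 else g (insert i C))) / real (Suc n)" for n g
    using sum_subsets_Suc[OF I, of n g] by (simp add: field_simps)
  show ?thesis
    unfolding numeral_2_eq_2 S sum_subsets_0[OF I]
    by (simp add: sum_divide_distrib[symmetric])
qed

lemma sum_subsets_4:
  fixes g :: "'i set \<Rightarrow> real"
  assumes I: "finite I"
  shows "24 * (\<Sum>B | B \<subseteq> I \<and> card B = 4. g B)
    = (\<Sum>i\<in>I. \<Sum>j\<in>I. \<Sum>k\<in>I. \<Sum>l\<in>I. if distinct [i, j, k, l] then g {i, j, k, l} else 0)"
proof -
  let ?S = "\<lambda>n g. \<Sum>B | B \<subseteq> I \<and> card B = n. g B :: real"
  have S: "?S (Suc n) g = (\<Sum>i\<in>I. ?S n (\<lambda>C. if i \<in> C then 0 else g (insert i C))) / real (Suc n)" for n g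
    using sum_subsets_Suc[OF I, of n g] by (simp add: field_simps)
  have 4: "(4::nat) = Suc (Suc (Suc (Suc 0)))" by simp
  show ?thesis
    unfolding 4 S sum_subsets_0[OF I]
    by (simp add: sum_divide_distrib[symmetric]) (intro sum.cong refl, auto)
qed

lemma det_4_cart:
  fixes A :: "real ^ 4 ^ 4"
  shows "det A = det4 (\<lambda>i. A $ i $ 1) (\<lambda>i. A $ i $ 2) (\<lambda>i. A $ i $ 3) (\<lambda>i. A $ i $ 4) 1 2 3 4"
proof -
  have f1: "finite {2::4, 3, 4}" "1 \<notin> {2::4, 3, 4}" by auto
  have f2: "finite {3::4, 4}" "2 \<notin> {3::4, 4}" by auto
  have f3: "finite {4::4}" "3 \<notin> {4::4}" by auto
  show ?thesis
    unfolding det_def UNIV_4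
    unfolding sum_over_permutations_insert[OF f1] sum_over_permutations_insert[OF f2] sum_over_permutations_insert[OF f3]
    unfolding permutes_sing det4_expand
    by (simp add: sign_swap_id permutation_swap_id permutation_compose sign_compose sign_id swap_id_eq algebra_simps)
qed

text \<open>The factor 24 turns 4-element subsets into ordered quadruples. Quadruples with a
  repeated index may be included since their determinant is 0.\<close>

lemma measure_sum_segments_4:
  fixes v :: "'i \<Rightarrow> real ^ 4"
  assumes I: "finite I"
  shows "24 * measure lebesgue (\<Sum>i\<in>I. closed_segment 0 (v i))
    = (\<Sum>i\<in>I. \<Sum>j\<in>I. \<Sum>k\<in>I. \<Sum>l\<in>I. \<bar>det4 (\<lambda>i. v i $ 1) (\<lambda>i. v i $ 2) (\<lambda>i. v i $ 3) (\<lambda>i. v i $ 4) i j k l\<bar>)"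
proof -
  let ?d = "det4 (\<lambda>i. v i $ 1) (\<lambda>i. v i $ 2) (\<lambda>i. v i $ 3) (\<lambda>i. v i $ 4)"
  have "measure lebesgue (\<Sum>a\<in>{i, j, k, l}. closed_segment 0 (v a)) = \<bar>?d i j k l\<bar>" if d: "distinct [i, j, k, l]" for i j k l
  proof -
    define w :: "4 \<Rightarrow> real ^ 4" where "w m = (if m = 1 then v i else if m = 2 then v j else if m = 3 then v k else v l)" for m
    have "(\<Sum>a\<in>{i, j, k, l}. closed_segment 0 (v a)) = (\<Sum>m\<in>UNIV. closed_segment 0 (w m))"
      using d unfolding sum_4 w_def by (simp add: add.assoc)
    moreover have "det (\<chi> m. w m) = ?d i j k l" unfolding det_4_cart by (simp add: det4_expand w_def)
    ultimately show ?thesis by (simp add: measure_parallelepiped)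
  qed
  moreover have "?d i j k l = 0" if "\<not> distinct [i, j, k, l]" for i j k l
    using that by (auto simp: det4_expand algebra_simps)
  ultimately have "(if distinct [i, j, k, l] then measure lebesgue (\<Sum>a\<in>{i, j, k, l}. closed_segment 0 (v a)) else 0) = \<bar>?d i j k l\<bar>" for i j k l
    by simp
  then show ?thesis
    unfolding measure_sum_segments[OF I, of v] by (simp add: sum_subsets_4[OF I])
qed

lemma measure_sum_segments_2:
  fixes v :: "'i \<Rightarrow> real ^ 2"
  assumes I: "finite I"
  shows "2 * measure lebesgue (\<Sum>i\<in>I. closed_segment 0 (v i))
    = (\<Sum>i\<in>I. \<Sum>j\<in>I. \<bar>det2 (\<lambda>i. v i $ 1) (\<lambda>i. v i $ 2) i j\<bar>)"
proof -
  let ?d = "det2 (\<lambda>i. v i $ 1) (\<lambda>i. v i $ 2)"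
  have "measure lebesgue (\<Sum>a\<in>{i, j}. closed_segment 0 (v a)) = \<bar>?d i j\<bar>" if d: "i \<noteq> j" for i j
  proof -
    define w :: "2 \<Rightarrow> real ^ 2" where "w m = (if m = 1 then v i else v j)" for m
    have "(\<Sum>a\<in>{i, j}. closed_segment 0 (v a)) = (\<Sum>m\<in>UNIV. closed_segment 0 (w m))"
      using d unfolding sum_2 w_def by simp
    moreover have "det (\<chi> m. w m) = ?d i j" unfolding det_2 by (simp add: det2_def w_def mult.commute)
    ultimately show ?thesis by (simp add: measure_parallelepiped)
  qed
  moreover have "?d i i = 0" for i by (simp add: det2_def)
  ultimately have "(if i = j then 0 else measure lebesgue (\<Sum>a\<in>{i, j}. closed_segment 0 (v a))) = \<bar>?d i j\<bar>" for i j
    by simp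
  then show ?thesis
    unfolding measure_sum_segments[OF I, of v] by (simp add: sum_subsets_2[OF I])
qed

lemma measure_sum_segments_1:
  fixes v :: "'i \<Rightarrow> real ^ 1"
  assumes I: "finite I"
  shows "measure lebesgue (\<Sum>i\<in>I. closed_segment 0 (v i)) = (\<Sum>i\<in>I. \<bar>v i $ 1\<bar>)"
proof -
  have "measure lebesgue (closed_segment 0 (v i)) = \<bar>v i $ 1\<bar>" for i
    using measure_parallelepiped[of "\<lambda>_::1. v i"] by (simp add: det_1)
  moreover have "{B. B \<subseteq> I \<and> card B = 1} = (\<lambda>i. {i}) ` I" by (auto simp: card_1_singleton_iff)
  ultimately show ?thesis
    unfolding measure_sum_segments[OF I, of v] by (simp add: sum.reindex)
qed

section \<open>Coordinate projections and approximation\<close>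

text \<open>Where \<open>coord_proj\<close> stays in the ambient space, this lands in a space of the
  right dimension, whose Lebesgue measure is the volume wanted.\<close>

definition sel :: "('m \<Rightarrow> 'n) \<Rightarrow> real ^ 'n \<Rightarrow> real ^ 'm" where
  "sel \<sigma> x = (\<chi> k. x $ \<sigma> k)"

lemma linear_sel: "linear (sel \<sigma>)"
  by (rule linearI) (simp_all add: sel_def vec_eq_iff)

lemma measurable_select_cart:
  fixes \<sigma> :: "'m::finite \<Rightarrow> 'i"
  shows "(\<lambda>f. \<chi> k. f (\<sigma> k)) \<in> borel_measurable (\<Pi>\<^sub>M i\<in>range \<sigma>. (lborel :: real measure))"
    (is "?h \<in> borel_measurable ?P")
proof (subst borel_measurable_euclidean_space, intro ballI)
  fix b :: "real ^ 'm" assume "b \<in> Basis"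
  then obtain k where "b = axis k 1" by (auto simp: Basis_vec_def)
  then show "(\<lambda>f. ?h f \<bullet> b) \<in> borel_measurable ?P"
    by (simp add: inner_axis)
qed

text \<open>It suffices to compare the measures on open boxes, and the preimage of a box is a
  product of intervals, relabelled along \<open>\<sigma>\<close>.\<close>

lemma distr_PiM_lborel_cart:
  fixes \<sigma> :: "'m::finite \<Rightarrow> 'i"
  assumes "inj \<sigma>"
  shows "distr (\<Pi>\<^sub>M i\<in>range \<sigma>. (lborel :: real measure)) borel (\<lambda>f. \<chi> k. f (\<sigma> k)) = (lborel :: (real ^ 'm) measure)"
proof (rule lborel_eqI[symmetric])
  let ?P = "\<Pi>\<^sub>M i\<in>range \<sigma>. (lborel :: real measure)" and ?h = "\<lambda>f. \<chi> k. f (\<sigma> k) :: real ^ 'm"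
  interpret product_sigma_finite "\<lambda>_. lborel :: real measure" ..
  have h: "?h \<in> borel_measurable ?P" by (rule measurable_select_cart)
  have B: "(Basis :: (real ^ 'm) set) = range (\<lambda>k. axis k 1)" "inj (\<lambda>k. axis k 1 :: real ^ 'm)"
    by (auto simp: Basis_vec_def inj_on_def axis_eq_axis)
  fix l u :: "real ^ 'm" assume "\<And>b. b \<in> Basis \<Longrightarrow> l \<bullet> b \<le> u \<bullet> b"
  then have lu: "l $ k \<le> u $ k" for k
    unfolding B(1) by (force simp: inner_axis)
  have vi: "?h -` box l u \<inter> space ?P = (\<Pi>\<^sub>E i\<in>range \<sigma>. {l $ inv \<sigma> i <..< u $ inv \<sigma> i})"
    using assms by (auto simp: space_PiM mem_box_cart PiE_iff)
  have "emeasure (distr ?P borel ?h) (box l u) = (\<Prod>i\<in>range \<sigma>. ennreal (u $ inv \<sigma> i - l $ inv \<sigma> i))"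
    using h lu by (simp add: emeasure_distr vi emeasure_PiM)
  also have "\<dots> = (\<Prod>k\<in>UNIV. ennreal (u $ k - l $ k))"
    using assms by (simp add: prod.reindex)
  also have "\<dots> = ennreal (\<Prod>k\<in>UNIV. u $ k - l $ k)"
    using lu by (simp add: prod_ennreal)
  also have "(\<Prod>k\<in>UNIV. u $ k - l $ k) = (\<Prod>b\<in>Basis. (u - l) \<bullet> b)"
    unfolding B(1) using B(2) by (simp add: prod.reindex inner_axis)
  finally show "emeasure (distr ?P borel ?h) (box l u) = ennreal (\<Prod>b\<in>Basis. (u - l) \<bullet> b)" .
qed simp

lemma coord_vol_proj:
  fixes S :: "(real ^ 'n::finite) set" and \<sigma> :: "'m::finite \<Rightarrow> 'n"
  assumes S: "compact S" and "inj \<sigma>"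
  shows "coord_vol (range \<sigma>) (coord_proj (range \<sigma>) ` S) = measure lebesgue (sel \<sigma> ` S)"
proof -
  let ?I = "range \<sigma>"
  let ?P = "\<Pi>\<^sub>M i\<in>?I. (lborel :: real measure)" and ?h = "\<lambda>f. \<chi> k. f (\<sigma> k) :: real ^ 'm"
  have h: "?h \<in> borel_measurable ?P" by (rule measurable_select_cart)
  have "compact (sel \<sigma> ` S)"
    using S linear_sel by (intro compact_continuous_image linear_continuous_on) (auto simp: linear_conv_bounded_linear)
  then have meas: "sel \<sigma> ` S \<in> sets borel" by (rule borel_compact)
  \<comment> \<open>A point of the product space is determined by its values on the range of
    \<open>\<sigma>\<close>, so the set measured by \<open>coord_vol\<close> is the full preimage of
    a compact set and its measure passes to the image measure.\<close>
  have "(\<lambda>x. \<lambda>i\<in>?I. x $ i) ` coord_proj ?I ` S = ?h -` (sel \<sigma> ` S) \<inter> space ?P"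
  proof (intro equalityI subsetI)
    fix f assume "f \<in> (\<lambda>x. \<lambda>i\<in>?I. x $ i) ` coord_proj ?I ` S"
    then obtain x where x: "x \<in> S" "f = (\<lambda>i\<in>?I. coord_proj ?I x $ i)" by blast
    have "?h f = sel \<sigma> x" unfolding x(2) by (simp add: vec_eq_iff sel_def coord_proj_def)
    then show "f \<in> ?h -` (sel \<sigma> ` S) \<inter> space ?P"
      using x by (auto simp: space_PiM)
  next
    fix f assume "f \<in> ?h -` (sel \<sigma> ` S) \<inter> space ?P"
    then obtain x where x: "x \<in> S" "?h f = sel \<sigma> x" and f: "f \<in> extensional ?I" by (auto simp: space_PiM PiE_def)
    have "f (\<sigma> k) = x $ \<sigma> k" for k using x(2) by (simp add: sel_def vec_eq_iff)
    then have "f = (\<lambda>i\<in>?I. coord_proj ?I x $ i)"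
      using f by (auto simp: coord_proj_def fun_eq_iff restrict_def extensional_def)
    then show "f \<in> (\<lambda>x. \<lambda>i\<in>?I. x $ i) ` coord_proj ?I ` S" using x(1) by blast
  qed
  then have "coord_vol ?I (coord_proj ?I ` S) = measure (distr ?P borel ?h) (sel \<sigma> ` S)"
    unfolding coord_vol_def using h meas by (simp add: measure_distr)
  then show ?thesis
    unfolding distr_PiM_lborel_cart[OF assms(2)] using meas by simp
qed

section \<open>Zonotopes approximating a zonoid from outside\<close>

lemma zonotope_translate_sum:
  assumes "zonotope Z"
  obtains m :: nat and p v where "Z = {p} + (\<Sum>i<m. closed_segment 0 (v i))"
proof -
  obtain m :: nat and a b where Z: "Z = (\<Sum>i<m. closed_segment (a i) (b i))"
    using assms unfolding zonotope_def by blast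
  have "closed_segment (a i) (b i) = {a i} + closed_segment 0 (b i - a i)" for i
    using closed_segment_translation[of "a i" 0 "b i - a i"] by (auto simp: set_plus_def)
  moreover have "(\<Sum>i<m. {a i}) = {\<Sum>i<m. a i}"
    by (induction m) (auto simp: set_zero set_plus_def)
  ultimately have "Z = {\<Sum>i<m. a i} + (\<Sum>i<m. closed_segment 0 (b i - a i))"
    unfolding Z by (simp add: sum.distrib)
  then show ?thesis by (rule that)
qed

lemma compact_zonotope: "zonotope Z \<Longrightarrow> compact Z"
  unfolding zonotope_def by (auto intro!: compact_set_sum)

lemma zonotope_nonempty: "zonotope Z \<Longrightarrow> Z \<noteq> {}"
  unfolding zonotope_def by (auto simp: set_sum_alt)

lemma zonotope_plus_segment:
  assumes "zonotope Z"
  shows "zonotope (Z + closed_segment c d)"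
proof -
  obtain m :: nat and a b where Z: "Z = (\<Sum>i<m. closed_segment (a i) (b i))"
    using assms unfolding zonotope_def by blast
  have "Z + closed_segment c d = (\<Sum>i<Suc m. closed_segment ((a(m := c)) i) ((b(m := d)) i))"
    unfolding Z by simp
  then show ?thesis unfolding zonotope_def by blast
qed

lemma zonotope_plus_segments:
  assumes "zonotope Z" "finite B"
  shows "zonotope (Z + (\<Sum>b\<in>B. closed_segment (c b) (d b)))"
  using assms(2)
proof induction
  case empty
  then show ?case using assms(1) by simp
next
  case (insert b B)
  then show ?case using zonotope_plus_segment[OF insert.IH, of "c b" "d b"] by (simp add: add_ac)
qed

text \<open>Compactness bounds the distances from above, so that the suprema in
  \<open>hausdorff_dist\<close> really dominate them.\<close>

lemma hausdorff_dist_less: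
  fixes S T :: "'a::metric_space set"
  assumes "compact S" "compact T" "S \<noteq> {}" "T \<noteq> {}" "hausdorff_dist S T < e"
  shows "x \<in> S \<Longrightarrow> infdist x T < e" "y \<in> T \<Longrightarrow> infdist y S < e"
proof -
  have bdd: "bdd_above ((\<lambda>x. infdist x V) ` U)" if "compact U" for U V :: "'a set"
    using that by (intro bounded_imp_bdd_above compact_imp_bounded compact_continuous_image continuous_intros)
  show "infdist x T < e" if "x \<in> S"
    using cSUP_upper[OF that bdd[OF assms(1)], of T] assms(5) unfolding hausdorff_dist_def by linarith
  show "infdist y S < e" if "y \<in> T"
    using cSUP_upper[OF that bdd[OF assms(2)], of S] assms(5) unfolding hausdorff_dist_def by linarith
qed

text \<open>Adding a small cube to a nearby zonotope keeps it a zonotope and makes it contain \<open>A\<close>.\<close>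

lemma zonoid_enclosing_zonotope:
  fixes A :: "'a::euclidean_space set"
  assumes "zonoid A" "e > 0"
  obtains W where "zonotope W" "A \<subseteq> W" "W \<subseteq> {x. infdist x A \<le> (real DIM('a) + 1) * e}"
proof -
  obtain Z where A: "compact A" "A \<noteq> {}" and Z: "\<And>k. zonotope (Z k)"
    and lim: "(\<lambda>k. hausdorff_dist (Z k) A) \<longlonglongrightarrow> 0"
    using assms(1) unfolding zonoid_def by blast
  obtain k where k: "hausdorff_dist (Z k) A < e"
    using order_tendstoD(2)[OF lim assms(2)] by (auto simp: eventually_sequentially)
  note near = hausdorff_dist_less[OF compact_zonotope[OF Z[of k]] A(1) zonotope_nonempty[OF Z[of k]] A(2) k]
  \<comment> \<open>The cube of half-width \<open>e\<close> is itself a sum of segments. It contains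
    the ball of radius \<open>e\<close>, which covers the distance from \<open>A\<close> to
    \<open>Z k\<close>, and its points have norm at most \<open>DIM('a) * e\<close>; with the
    distance from \<open>Z k\<close> to \<open>A\<close> this gives the factor
    \<open>DIM('a) + 1\<close>.\<close>
  define C where "C = (\<Sum>b\<in>Basis. closed_segment (- e *\<^sub>R b) (e *\<^sub>R (b::'a)))"
  have CE: "C = {sum s Basis | s. \<forall>b\<in>Basis. s b \<in> closed_segment (- e *\<^sub>R b) (e *\<^sub>R b)}"
    unfolding C_def by (rule set_sum_alt) simp
  show ?thesis
  proof (rule that[of "Z k + C"])
    show "zonotope (Z k + C)" unfolding C_def by (intro zonotope_plus_segments Z) simp
    show "A \<subseteq> Z k + C"
    proof
      fix x assume x: "x \<in> A"
      obtain z where z: "z \<in> Z k" "infdist x (Z k) = dist x z"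
        using infdist_attains_inf[OF compact_imp_closed[OF compact_zonotope[OF Z[of k]]] zonotope_nonempty[OF Z[of k]]] by metis
      then have d: "norm (x - z) < e" using near(2)[OF x] by (simp add: dist_norm)
      have "((x - z) \<bullet> b) *\<^sub>R b \<in> closed_segment (- e *\<^sub>R b) (e *\<^sub>R b)" if "b \<in> Basis" for b
      proof -
        let ?c = "(x - z) \<bullet> b"
        have "\<bar>?c\<bar> \<le> e" using Basis_le_norm[OF that, of "x - z"] d by linarith
        moreover have "?c *\<^sub>R b = (1 - (?c + e) / (2 * e)) *\<^sub>R (- e *\<^sub>R b) + ((?c + e) / (2 * e)) *\<^sub>R (e *\<^sub>R b)"
          using assms(2) by (simp add: scaleR_add_left[symmetric] field_simps flip: scaleR_minus_left scaleR_diff_left)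
        ultimately show ?thesis unfolding closed_segment_def using assms(2)
          by (intro CollectI exI[of _ "(?c + e) / (2 * e)"]) (auto simp: field_simps)
      qed
      then have "x - z \<in> C" unfolding CE
        by (intro CollectI exI[of _ "\<lambda>b. ((x - z) \<bullet> b) *\<^sub>R b"]) (simp add: euclidean_representation)
      then have "z + (x - z) \<in> Z k + C" using z by blast
      then show "x \<in> Z k + C" by simp
    qed
    show "Z k + C \<subseteq> {x. infdist x A \<le> (real DIM('a) + 1) * e}"
    proof
      fix x assume "x \<in> Z k + C"
      then obtain z c where z: "z \<in> Z k" "c \<in> C" "x = z + c" by (auto simp: set_plus_def)
      then obtain s where s: "c = sum s Basis" "\<And>b. b \<in> Basis \<Longrightarrow> s b \<in> closed_segment (- e *\<^sub>R b) (e *\<^sub>R b)"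
        unfolding CE by blast
      have "norm (s b) \<le> e" if "b \<in> Basis" for b
      proof -
        have "s b \<in> cball 0 e"
        proof (rule subsetD[OF closed_segment_subset s(2)[OF that]])
        qed (use that assms(2) in auto)
        then show ?thesis by simp
      qed
      then have "norm c \<le> real DIM('a) * e" unfolding s(1) by (rule sum_norm_bound)
      moreover have "infdist x A \<le> infdist z A + dist x z" by (rule infdist_triangle)
      ultimately have "infdist x A \<le> e + real DIM('a) * e"
        using near(1)[OF z(1)] z(3) by (simp add: dist_norm)
      then show "x \<in> {x. infdist x A \<le> (real DIM('a) + 1) * e}" by (simp add: algebra_simps)
    qed
  qed
qed

text \<open>The neighbourhoods are compact and decrease to the closed set \<open>K\<close>, so
  continuity of measure from above applies.\<close>

lemma measure_closed_nbhd_tendsto: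
  fixes K :: "'a::euclidean_space set"
  assumes K: "compact K" "K \<noteq> {}" and D: "0 < D"
  shows "(\<lambda>n. measure lebesgue {x. infdist x K \<le> D / real (Suc n)}) \<longlonglongrightarrow> measure lebesgue K"
proof -
  define N where "N n = {x. infdist x K \<le> D / real (Suc n)}" for n
  have cN: "compact (N n)" for n
    unfolding N_def by (rule compact_infdist_le) (use K D in auto)
  have "(\<Inter>n. N n) = K"
  proof (intro equalityI subsetI)
    fix x assume x: "x \<in> (\<Inter>n. N n)"
    have "(\<lambda>n. D / real (Suc n)) \<longlonglongrightarrow> 0"
      by (rule LIMSEQ_Suc) (rule lim_const_over_n)
    then have "infdist x K \<le> 0"
      by (rule LIMSEQ_le_const) (use x in \<open>auto simp: N_def\<close>)
    then have "infdist x K = 0" using infdist_nonneg[of x K] by linarith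
    then show "x \<in> K" using in_closed_iff_infdist_zero[OF compact_imp_closed[OF K(1)] K(2)] by simp
  next
    fix x assume "x \<in> K"
    then show "x \<in> (\<Inter>n. N n)" using D by (auto simp: N_def)
  qed
  moreover have "(\<lambda>n. measure lebesgue (N n)) \<longlonglongrightarrow> measure lebesgue (\<Inter>n. N n)"
  proof (rule Lim_measure_decseq)
    show "range N \<subseteq> sets lebesgue" using cN lmeasurable_compact by blast
    have "D / real (Suc n) \<le> D / real (Suc m)" if "m \<le> n" for m n
      using that D by (intro divide_left_mono) auto
    then show "decseq N" unfolding decseq_def N_def by (blast intro: order_trans)
    show "emeasure lebesgue (N i) \<noteq> \<infinity>" for i
      using fmeasurableD2[OF lmeasurable_compact[OF cN]] by simp
  qed
  ultimately show ?thesis unfolding N_def by simp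
qed

text \<open>The image of \<open>W n\<close> contains that of \<open>A\<close>, and a bound
  \<open>B\<close> for \<open>f\<close> puts it within \<open>B * D / (n + 1)\<close> of it. The
  measures are squeezed between that of the image of \<open>A\<close> and those of its shrinking
  neighbourhoods.\<close>

lemma measure_linear_image_tendsto:
  fixes f :: "'a::euclidean_space \<Rightarrow> 'b::euclidean_space"
  assumes f: "linear f" and A: "compact A" "A \<noteq> {}" and W: "\<And>n. compact (W n)" "\<And>n. A \<subseteq> W n"
    and near: "\<And>n. W n \<subseteq> {x. infdist x A \<le> D / real (Suc n)}" and D: "0 < D"
  shows "(\<lambda>n. measure lebesgue (f ` W n)) \<longlonglongrightarrow> measure lebesgue (f ` A)"
proof -
  obtain B where B: "B > 0" "\<And>x. norm (f x) \<le> B * norm x" using linear_bounded_pos[OF f] by blast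
  have cf: "compact (f ` S)" if "compact S" for S
    using that f by (intro compact_continuous_image linear_continuous_on) (auto simp: linear_conv_bounded_linear)
  have lm: "f ` S \<in> lmeasurable" if "compact S" for S
    using cf[OF that] by (rule lmeasurable_compact)
  let ?N = "\<lambda>n. {y. infdist y (f ` A) \<le> (B * D) / real (Suc n)}"
  have sub: "f ` W n \<subseteq> ?N n" for n
  proof
    fix y assume "y \<in> f ` W n"
    then obtain w where w: "w \<in> W n" "y = f w" by blast
    obtain a where a: "a \<in> A" "infdist w A = dist w a"
      using infdist_attains_inf[OF compact_imp_closed[OF A(1)] A(2)] by metis
    have "infdist y (f ` A) \<le> dist y (f a)" using a by (intro infdist_le) auto
    also have "\<dots> \<le> B * dist w a" using B(2)[of "w - a"] by (simp add: w dist_norm linear_diff[OF f])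
    also have "\<dots> \<le> B * (D / real (Suc n))" using near[of n] w a B by (intro mult_left_mono) auto
    finally show "y \<in> ?N n" by simp
  qed
  have "compact (?N n)" for n
    by (rule compact_infdist_le) (use cf A B D in auto)
  then have N: "?N n \<in> lmeasurable" for n by (rule lmeasurable_compact)
  show ?thesis
  proof (rule tendsto_sandwich[where f = "\<lambda>_. measure lebesgue (f ` A)" and h = "\<lambda>n. measure lebesgue (?N n)"])
    show "(\<lambda>n. measure lebesgue (?N n)) \<longlonglongrightarrow> measure lebesgue (f ` A)"
      by (rule measure_closed_nbhd_tendsto) (use cf A B D in auto)
    show "(\<lambda>n. measure lebesgue (f ` A)) \<longlonglongrightarrow> measure lebesgue (f ` A)" by simp
    show "\<forall>\<^sub>F n in sequentially. measure lebesgue (f ` A) \<le> measure lebesgue (f ` W n)"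
      using W(2) lm[OF A(1)] lm[OF W(1)] by (intro always_eventually allI measure_mono_fmeasurable image_mono) auto
    show "\<forall>\<^sub>F n in sequentially. measure lebesgue (f ` W n) \<le> measure lebesgue (?N n)"
      using N sub lm[OF W(1)] by (intro always_eventually allI measure_mono_fmeasurable) auto
  qed
qed

lemma measure_linear_image_translate_sum:
  fixes f :: "'a::euclidean_space \<Rightarrow> 'b::euclidean_space"
  assumes "linear f"
  shows "measure lebesgue (f ` ({p} + (\<Sum>i\<in>I. closed_segment 0 (v i)))) = measure lebesgue (\<Sum>i\<in>I. closed_segment 0 (f (v i)))"
proof -
  have "f ` ({p} + (\<Sum>i\<in>I. closed_segment 0 (v i))) = {f p} + (\<Sum>i\<in>I. closed_segment 0 (f (v i)))"
    using assms by (simp add: image_set_plus image_set_sum closed_segment_linear_image[symmetric] linear_0)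
  also have "\<dots> = (+) (f p) ` (\<Sum>i\<in>I. closed_segment 0 (f (v i)))" by (auto simp: set_plus_def)
  finally show ?thesis by (simp add: measure_translation)
qed

section \<open>The inequality for zonotopes and passage to the limit\<close>

definition pair_index :: "'n \<Rightarrow> 'n \<Rightarrow> 2 \<Rightarrow> 'n" where
  "pair_index a b k = (if k = 1 then a else b)"

lemma range_pair_index: "range (pair_index a b) = {a, b}"
  by (auto simp: pair_index_def UNIV_2)

lemma inj_pair_index: "a \<noteq> b \<Longrightarrow> inj (pair_index a b)"
  unfolding inj_def forall_2 by (auto simp: pair_index_def)

text \<open>All volumes are written for linear images, with \<open>id\<close> for the full one, so
  that a single limit lemma covers every factor. The normalisations 24 and 2 of the determinant sums
  cancel against the 3 of \<open>det_sum_inequality\<close>.\<close>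

lemma zonotope_inequality:
  fixes Z :: "(real ^ 4) set"
  assumes "zonotope Z"
  shows "measure lebesgue (id ` Z) * (measure lebesgue (sel (\<lambda>_::1. 4) ` Z))\<^sup>2
    \<le> measure lebesgue (sel (pair_index 1 4) ` Z) * measure lebesgue (sel (pair_index 2 4) ` Z)
      * measure lebesgue (sel (pair_index 3 4) ` Z)"
proof -
  obtain m :: nat and p v where Z: "Z = {p} + (\<Sum>i<m. closed_segment 0 (v i))"
    using zonotope_translate_sum[OF assms] .
  let ?I = "{..<m}"
  have fin: "finite ?I" by simp
  have 4: "24 * measure lebesgue (id ` Z)
    = (\<Sum>i<m. \<Sum>j<m. \<Sum>k<m. \<Sum>l<m. \<bar>det4 (\<lambda>i. v i $ 1) (\<lambda>i. v i $ 2) (\<lambda>i. v i $ 3) (\<lambda>i. v i $ 4) i j k l\<bar>)"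
    unfolding Z measure_linear_image_translate_sum[OF linear_id] using measure_sum_segments_4[OF fin, of v] by simp
  have 2: "2 * measure lebesgue (sel (pair_index a 4) ` Z) = (\<Sum>i<m. \<Sum>j<m. \<bar>det2 (\<lambda>i. v i $ a) (\<lambda>i. v i $ 4) i j\<bar>)" for a
    unfolding Z measure_linear_image_translate_sum[OF linear_sel] measure_sum_segments_2[OF fin]
    by (simp add: sel_def pair_index_def det2_def)
  have 1: "measure lebesgue (sel (\<lambda>_::1. 4) ` Z) = (\<Sum>i<m. \<bar>v i $ 4\<bar>)"
    unfolding Z measure_linear_image_translate_sum[OF linear_sel] measure_sum_segments_1[OF fin]
    by (simp add: sel_def)
  have "3 * (2 * a) * (2 * b) * (2 * c) = 24 * (a * b * c)" for a b c :: real by simp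
  then show ?thesis
    using det_sum_inequality[OF fin, of "\<lambda>i. v i $ 4" "\<lambda>i. v i $ 1" "\<lambda>i. v i $ 2" "\<lambda>i. v i $ 3"]
    unfolding 4[symmetric] 2[symmetric] 1[symmetric] by (simp add: mult_ac)
qed

theorem mainTheorem4:
  fixes A :: "(real ^ 4) set"
  assumes "zonoid A"
  shows "measure lebesgue A * (coord_vol {4} (coord_proj {4} ` A))\<^sup>2
    \<le> coord_vol {1, 4} (coord_proj {1, 4} ` A) *
      coord_vol {2, 4} (coord_proj {2, 4} ` A) *
      coord_vol {3, 4} (coord_proj {3, 4} ` A)"
proof -
  have A: "compact A" "A \<noteq> {}" using assms unfolding zonoid_def by auto
  \<comment> \<open>The 5 is \<open>DIM('a) + 1\<close> for dimension 4, with
    \<open>e = 1 / (n + 1)\<close>.\<close>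
  have "\<exists>W. zonotope W \<and> A \<subseteq> W \<and> W \<subseteq> {x. infdist x A \<le> 5 / real (Suc n)}" for n
    by (rule zonoid_enclosing_zonotope[OF assms, of "1 / real (Suc n)"]) auto
  then obtain W where W: "\<And>n. zonotope (W n)" "\<And>n. A \<subseteq> W n" "\<And>n. W n \<subseteq> {x. infdist x A \<le> 5 / real (Suc n)}"
    by metis
  have lim: "(\<lambda>n. measure lebesgue (f ` W n)) \<longlonglongrightarrow> measure lebesgue (f ` A)" if "linear f" for f :: "real ^ 4 \<Rightarrow> 'b::euclidean_space"
    by (rule measure_linear_image_tendsto[OF that A compact_zonotope[OF W(1)] W(2,3)]) simp
  let ?L = "\<lambda>S. measure lebesgue (id ` S) * (measure lebesgue (sel (\<lambda>_::1. 4) ` S))\<^sup>2"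
  let ?R = "\<lambda>S. measure lebesgue (sel (pair_index 1 4) ` S) * measure lebesgue (sel (pair_index 2 4) ` S)
      * measure lebesgue (sel (pair_index 3 4) ` S)"
  have L: "(\<lambda>n. ?L (W n)) \<longlonglongrightarrow> ?L A"
    by (intro tendsto_mult tendsto_power lim linear_id linear_sel)
  have R: "(\<lambda>n. ?R (W n)) \<longlonglongrightarrow> ?R A"
    by (intro tendsto_mult lim linear_sel)
  have main: "?L A \<le> ?R A"
    by (rule LIMSEQ_le[OF L R]) (intro exI allI impI zonotope_inequality W(1))
  have cv2: "coord_vol {a, 4} (coord_proj {a, 4} ` A) = measure lebesgue (sel (pair_index a 4) ` A)" if "a \<noteq> 4" for a :: 4
    using coord_vol_proj[OF A(1) inj_pair_index[OF that]] unfolding range_pair_index .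
  \<comment> \<open>The singleton is the range of the constant map from the one-element index type,
    which is injective.\<close>
  have "coord_vol {4} (coord_proj {4} ` A) = measure lebesgue (sel (\<lambda>_::1. 4) ` A)"
    using coord_vol_proj[OF A(1), of "\<lambda>_::1. 4"] by (simp add: inj_def image_constant_conv)
  then show ?thesis using main by (simp add: cv2)
qed

end
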